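(* For every $r\in(1,\infty)$, the spaces $H^{1,r}(\gamma)$ and $H^{1,\infty}(\gamma)$ on $\mathbb{R}^n$ coincide, with equivalent norms.
   Context: $\gamma$ is the Gauss measure on $\mathbb{R}^n$, with density $\gamma_0(x)=\pi^{-n/2}e^{-|x|^2}$ with respect to Lebesgue measure; $\|\cdot\|_r$ is the norm of $L^r(\gamma)$. A closed Euclidean ball $B$ with radius $r_B$ and centre $c_B$ is called admissible if $r_B\le \min(1,1/|c_B|)$ (where $\min(1,1/|x|)=1$ for $x=0$). For $r\in(1,\infty]$, a Gaussian $(1,r)$-atom is either the constant function $1$ or a function $a\in L^r(\gamma)$ supported in an admissible ball $B$ such that $\int a\,d\gamma=0$ and $\|a\|_r\le\gamma(B)^{1/r-1}$ (with $1/\infty=0$). The space $H^{1,r}(\gamma)$ consists of all $f\in L^1(\gamma)$ that admit a decomposition $f=\sum_j\lambda_j a_j$ with $a_j$ Gaussian $(1,r)$-atoms and $(\lambda_j)$ a summable sequence of complex numbers. The norm $\|f\|_{H^{1,r}(\gamma)}$ is the infimum of $\sum_j|\lambda_j|$ over all such representations of $f$. *)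

theory Defs
  imports "HOL-Probability.Probability"
begin

definition gauss :: "'a::euclidean_space measure" where
  "gauss = density lborel
     (\<lambda>x. ennreal (pi powr (- real DIM('a) / 2) * exp (- (norm x)\<^sup>2)))"

(* Elements of L^r(M) are represented by measurable complex functions rather than by
   equivalence classes; membership in gauss_hardy and the value of gauss_hardy_norm do not
   change when such a function is modified on a null set. The exponent r is an extended real,
   with r = \<infinity> allowed. *)

definition Lr_space :: "'a measure \<Rightarrow> ereal \<Rightarrow> ('a \<Rightarrow> complex) set" where
  "Lr_space M r = {f \<in> borel_measurable M.
     if r = \<infinity> then esssup M (\<lambda>x. ereal (norm (f x))) < \<infinity>
     else integrable M (\<lambda>x. norm (f x) powr real_of_ereal r)}"

definition Lr_norm :: "'a measure \<Rightarrow> ereal \<Rightarrow> ('a \<Rightarrow> complex) \<Rightarrow> real" where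
  "Lr_norm M r f =
     (if r = \<infinity> then real_of_ereal (esssup M (\<lambda>x. ereal (norm (f x))))
      else (\<integral>x. norm (f x) powr real_of_ereal r \<partial>M) powr (1 / real_of_ereal r))"

definition admissible_radius :: "'a::euclidean_space \<Rightarrow> real" where
  "admissible_radius x = (if x = 0 then 1 else min 1 (1 / norm x))"

definition admissible_ball :: "'a::euclidean_space set \<Rightarrow> bool" where
  "admissible_ball B \<longleftrightarrow>
     (\<exists>c R. 0 < R \<and> R \<le> admissible_radius c \<and> B = cball c R)"

(* Support is understood almost everywhere. For r = \<infinity> the extended-real quotient 1 / r is 0. *)

definition gauss_atom :: "ereal \<Rightarrow> ('a::euclidean_space \<Rightarrow> complex) \<Rightarrow> bool" where
  "gauss_atom r a \<longleftrightarrow>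
     a = (\<lambda>_. 1) \<or>
     (a \<in> Lr_space gauss r \<and>
      (\<exists>B. admissible_ball B \<and>
           (AE x in gauss. x \<notin> B \<longrightarrow> a x = 0) \<and>
           (\<integral>x. a x \<partial>gauss) = 0 \<and>
           Lr_norm gauss r a \<le> measure gauss B powr (real_of_ereal (1 / r) - 1)))"

(* The series converges in L^1(gauss). Finite decompositions are
   covered by taking \<lambda>_j = 0 from some index on. *)

definition atomic_decomposition ::
  "ereal \<Rightarrow> ('a::euclidean_space \<Rightarrow> complex) \<Rightarrow> (nat \<Rightarrow> complex) \<Rightarrow> (nat \<Rightarrow> 'a \<Rightarrow> complex) \<Rightarrow> bool"
where
  "atomic_decomposition r f l a \<longleftrightarrow>
     (\<forall>j. gauss_atom r (a j)) \<and>
     summable (\<lambda>j. norm (l j)) \<and>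
     (\<lambda>N. \<integral>\<^sup>+x. ennreal (norm (f x - (\<Sum>j<N. l j * a j x))) \<partial>gauss) \<longlonglongrightarrow> 0"

definition gauss_hardy :: "ereal \<Rightarrow> ('a::euclidean_space \<Rightarrow> complex) set" where
  "gauss_hardy r = {f. integrable gauss f \<and> (\<exists>l a. atomic_decomposition r f l a)}"

definition gauss_hardy_norm :: "ereal \<Rightarrow> ('a::euclidean_space \<Rightarrow> complex) \<Rightarrow> real" where
  "gauss_hardy_norm r f =
     Inf {(\<Sum>j. norm (l j)) | l. \<exists>a. atomic_decomposition r f l a}"

end

theory Submission
  imports Defs
begin

text \<open>
By Hoelder's inequality every bounded atom, of exponent \<open>\<infinity>\<close>, is an \<open>r\<close>-atom for the same ball, so
one inclusion is immediate, with norms related by the constant 1. For the other one, let \<open>r\<close> be the real number \<open>p\<close>.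
It suffices to write every \<open>p\<close>-atom \<open>a\<close> as \<open>u + v\<close>, where \<open>u\<close> is a combination of bounded atoms of
total size at most a constant \<open>K\<close>, and \<open>v\<close> is a combination of \<open>p\<close>-atoms of total size at most \<open>1/2\<close>
(\<open>real_atom_split\<close>). Repeating this for the atoms in \<open>v\<close> gives a geometric series, so every
combination of \<open>p\<close>-atoms of size \<open>S\<close> is one of bounded atoms of size \<open>2 * K * S\<close>
(\<open>atomic_hull_iterate\<close>).

The splitting is a Calderon--Zygmund decomposition of \<open>a\<close> at height \<open>T = t / m\<close>, where \<open>m\<close> is the Gauss
measure of the ball \<open>B\<close> of \<open>a\<close> and \<open>t\<close> is a large number that depends only on \<open>p\<close> and the dimension
(\<open>bad_cells\<close>, \<open>atom_split\<close>). One stops at the maximal dyadic cubes over which the average of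
\<open>norm a powr p\<close> exceeds \<open>T powr p\<close>. Their total measure is at most \<open>m * t powr (- p)\<close>. The oscillation
of \<open>a\<close> on such a cube is a multiple of a \<open>p\<close>-atom, with a coefficient of order \<open>T\<close> times the measure
of the cube. The coefficients sum to order \<open>t powr (1 - p)\<close>, which is below \<open>1/2\<close> for large \<open>t\<close> because
\<open>p > 1\<close>. The remaining part \<open>u\<close> is bounded by a multiple of \<open>T\<close>. This rests on a weak form of
Lebesgue's differentiation theorem that follows from outer regularity (\<open>AE_le_off_bad_cells\<close>).

Two features are particular to the Gaussian setting. First, on an admissible ball, and on its double,
the Gaussian density is constant up to a fixed factor. Hence cubes of such a size are doubling, and
balls centred in \<open>B\<close> of at most half the radius are again admissible. Secondly, the cubes that meet
\<open>B\<close> stick out of \<open>B\<close>, and a slightly larger concentric ball need not be admissible. So \<open>u\<close> is cut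
into pieces on small cubes, and the mass of each piece is moved into \<open>B\<close> within a small admissible
ball (\<open>bounded_mean_zero_in_hull\<close>).
\<close>

section \<open>Combinations of atoms over a measure space\<close>

text \<open>By Tonelli the sum of the moduli has a finite integral, hence is finite almost everywhere.\<close>

lemma AE_summable_norm_if_summable_L1:
  fixes f :: "nat \<Rightarrow> 'a \<Rightarrow> complex"
  assumes f: "\<And>j. f j \<in> borel_measurable M"
    and bound: "\<And>j. (\<integral>\<^sup>+x. ennreal (norm (f j x)) \<partial>M) \<le> ennreal (c j)"
    and c: "\<And>j. 0 \<le> c j" "summable c"
  shows "AE x in M. summable (\<lambda>j. norm (f j x))"
proof -
  have "(\<integral>\<^sup>+x. (\<Sum>j. ennreal (norm (f j x))) \<partial>M) = (\<Sum>j. \<integral>\<^sup>+x. ennreal (norm (f j x)) \<partial>M)"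
    by (rule nn_integral_suminf) (use f in measurable)
  also have "\<dots> \<le> (\<Sum>j. ennreal (c j))"
    by (intro suminf_le bound) auto
  also have "\<dots> = ennreal (suminf c)"
    using c by (rule suminf_ennreal2)
  finally have "(\<integral>\<^sup>+x. (\<Sum>j. ennreal (norm (f j x))) \<partial>M) < \<infinity>"
    by (simp add: le_less_trans)
  then have "AE x in M. (\<Sum>j. ennreal (norm (f j x))) \<noteq> \<infinity>"
    by (intro nn_integral_PInf_AE) (use f in \<open>auto simp: less_top[symmetric]\<close>)
  then show ?thesis
    by eventually_elim (intro summable_suminf_not_top, auto)
qed

lemma nn_integral_norm_sums_le:
  fixes f :: "nat \<Rightarrow> 'a \<Rightarrow> complex"
  assumes f: "\<And>j. f j \<in> borel_measurable M"
    and bound: "\<And>j. (\<integral>\<^sup>+x. ennreal (norm (f j x)) \<partial>M) \<le> ennreal (c j)"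
    and c: "\<And>j. 0 \<le> c j" "summable c"
    and F: "AE x in M. (\<lambda>j. f j x) sums F x"
  shows "(\<integral>\<^sup>+x. ennreal (norm (F x)) \<partial>M) \<le> ennreal (suminf c)"
proof -
  have "AE x in M. ennreal (norm (F x)) \<le> (\<Sum>j. ennreal (norm (f j x)))"
    using F AE_summable_norm_if_summable_L1[OF f bound c]
  proof eventually_elim
    case (elim x)
    have "norm (F x) \<le> (\<Sum>j. norm (f j x))"
      using summable_norm[OF elim(2)] sums_unique[OF elim(1)] by simp
    moreover have "(\<Sum>j. ennreal (norm (f j x))) = ennreal (\<Sum>j. norm (f j x))"
      by (rule suminf_ennreal2) (use elim(2) in auto)
    ultimately show ?case
      by (simp only: ennreal_leI)
  qed
  then have "(\<integral>\<^sup>+x. ennreal (norm (F x)) \<partial>M) \<le> (\<integral>\<^sup>+x. (\<Sum>j. ennreal (norm (f j x))) \<partial>M)"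
    by (rule nn_integral_mono_AE)
  also have "\<dots> = (\<Sum>j. \<integral>\<^sup>+x. ennreal (norm (f j x)) \<partial>M)"
    by (rule nn_integral_suminf) (use f in measurable)
  also have "\<dots> \<le> (\<Sum>j. ennreal (c j))"
    by (intro suminf_le bound) auto
  also have "\<dots> = ennreal (suminf c)"
    using c by (rule suminf_ennreal2)
  finally show ?thesis .
qed

text \<open>For the norm given by the infimum of the coefficient sums, this set lies between the open and the
closed ball of radius \<open>S\<close> in the atomic space generated by \<open>A\<close>. The series is required to converge pointwise almost everywhere rather than
in \<open>L\<^sup>1\<close>: for atoms bounded in \<open>L\<^sup>1\<close> both modes agree (see \<open>L1_limit_iff_AE_sums\<close>
below), and pointwise series can be rearranged and regrouped by the theory of unconditional sums
of complex numbers.\<close>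

definition atomic_hull :: "'a measure \<Rightarrow> ('a \<Rightarrow> complex) set \<Rightarrow> real \<Rightarrow> ('a \<Rightarrow> complex) set" where
  "atomic_hull M A S = {f \<in> borel_measurable M.
     \<exists>l a. (\<forall>j. a j \<in> A) \<and> summable (\<lambda>j. norm (l j)) \<and> (\<Sum>j. norm (l j)) \<le> S \<and>
       (AE x in M. (\<lambda>j. l j * a j x) sums f x)}"

definition L1_bounded :: "'a measure \<Rightarrow> real \<Rightarrow> ('a \<Rightarrow> complex) set \<Rightarrow> bool" where
  "L1_bounded M L A \<longleftrightarrow> 0 \<le> L \<and> A \<noteq> {} \<and>
     (\<forall>a\<in>A. a \<in> borel_measurable M \<and> (\<integral>\<^sup>+x. ennreal (norm (a x)) \<partial>M) \<le> ennreal L)"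

lemma L1_boundedD:
  assumes "L1_bounded M L A"
  shows "0 \<le> L" "A \<noteq> {}" "a \<in> A \<Longrightarrow> a \<in> borel_measurable M"
    "a \<in> A \<Longrightarrow> (\<integral>\<^sup>+x. ennreal (norm (a x)) \<partial>M) \<le> ennreal L"
    "a \<in> A \<Longrightarrow> (\<integral>\<^sup>+x. ennreal (norm (l * a x)) \<partial>M) \<le> ennreal (norm l * L)"
proof -
  show *: "0 \<le> L" "A \<noteq> {}" "a \<in> A \<Longrightarrow> a \<in> borel_measurable M"
    "a \<in> A \<Longrightarrow> (\<integral>\<^sup>+x. ennreal (norm (a x)) \<partial>M) \<le> ennreal L"
    using assms by (auto simp: L1_bounded_def)
  assume a: "a \<in> A"
  have "(\<integral>\<^sup>+x. ennreal (norm (l * a x)) \<partial>M) = ennreal (norm l) * (\<integral>\<^sup>+x. ennreal (norm (a x)) \<partial>M)"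
    using *(3)[OF a] by (subst nn_integral_cmult[symmetric]) (auto simp: norm_mult ennreal_mult)
  also have "\<dots> \<le> ennreal (norm l) * ennreal L"
    by (intro mult_left_mono *(4) a) auto
  finally show "(\<integral>\<^sup>+x. ennreal (norm (l * a x)) \<partial>M) \<le> ennreal (norm l * L)"
    using *(1) by (simp add: ennreal_mult)
qed

lemma atomic_hullI:
  assumes "f \<in> borel_measurable M" "\<And>j. a j \<in> A" "summable (\<lambda>j. norm (l j))"
    "(\<Sum>j. norm (l j)) \<le> S" "AE x in M. (\<lambda>j. l j * a j x) sums f x"
  shows "f \<in> atomic_hull M A S"
  using assms unfolding atomic_hull_def by blast

lemma atomic_hull_measurable: "f \<in> atomic_hull M A S \<Longrightarrow> f \<in> borel_measurable M"
  by (auto simp: atomic_hull_def)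

lemma atomic_hull_bound_nonneg:
  assumes "f \<in> atomic_hull M A S" shows "0 \<le> S"
proof -
  obtain l :: "nat \<Rightarrow> complex" where "summable (\<lambda>j. norm (l j))" "(\<Sum>j. norm (l j)) \<le> S"
    using assms unfolding atomic_hull_def by blast
  then show ?thesis
    by (meson norm_ge_zero order_trans suminf_nonneg)
qed

lemma atomic_hull_mono:
  assumes "f \<in> atomic_hull M A S" "S \<le> T" shows "f \<in> atomic_hull M A T"
  using assms unfolding atomic_hull_def by (auto intro: order_trans)

lemma atomic_hull_L1_bound:
  assumes A: "L1_bounded M L A" and f: "f \<in> atomic_hull M A S"
  shows "(\<integral>\<^sup>+x. ennreal (norm (f x)) \<partial>M) \<le> ennreal (S * L)"
proof -
  obtain l a where *: "\<And>j. a j \<in> A" "summable (\<lambda>j. norm (l j))"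
    "(\<Sum>j. norm (l j)) \<le> S" "AE x in M. (\<lambda>j. l j * a j x) sums f x"
    using f unfolding atomic_hull_def by blast
  have "(\<integral>\<^sup>+x. ennreal (norm (f x)) \<partial>M) \<le> ennreal (\<Sum>j. norm (l j) * L)"
    by (rule nn_integral_norm_sums_le[where f="\<lambda>j x. l j * a j x"])
      (use *(1,2,4) L1_boundedD[OF A] in \<open>auto intro: summable_mult2 borel_measurable_times\<close>)
  also have "(\<Sum>j. norm (l j) * L) = (\<Sum>j. norm (l j)) * L"
    using *(2) by (rule suminf_mult2[symmetric])
  also have "\<dots> \<le> S * L"
    using *(3) L1_boundedD(1)[OF A] by (rule mult_right_mono)
  finally show ?thesis
    by (meson ennreal_leI order_trans order_refl)
qed

lemma atomic_hull_single:
  assumes "a \<in> A" "a \<in> borel_measurable M"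
  shows "(\<lambda>x. z * a x) \<in> atomic_hull M A (norm z)"
proof (rule atomic_hullI[where a="\<lambda>_. a" and l="\<lambda>j. if j = 0 then z else 0"])
  show "(\<lambda>x. z * a x) \<in> borel_measurable M" using assms by measurable
  have 1: "(\<lambda>j. norm (if j = 0 then z else 0)) sums (norm z)" 
    using sums_If_finite_set[of "{0::nat}" "\<lambda>_. norm z"] by (simp add: if_distrib cong: if_cong)
  show "summable (\<lambda>j::nat. norm (if j = 0 then z else 0))"
    "(\<Sum>j::nat. norm (if j = 0 then z else 0)) \<le> norm z"
    using sums_summable[OF 1] sums_unique[OF 1] by simp_all
  show "AE x in M. (\<lambda>j::nat. (if j = 0 then z else 0) * a x) sums (z * a x)"
  proof (rule AE_I2)
    fix x
    show "(\<lambda>j::nat. (if j = 0 then z else 0) * a x) sums (z * a x)"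
      using sums_If_finite_set[of "{0::nat}" "\<lambda>_. z * a x"] by (simp add: if_distrib if_distribR cong: if_cong)
  qed
qed (use assms in auto)

lemma atomic_hull_zero:
  assumes A: "L1_bounded M L A" and S: "0 \<le> S"
  shows "(\<lambda>x. 0) \<in> atomic_hull M A S"
proof -
  obtain a where "a \<in> A" using L1_boundedD(2)[OF A] by auto
  from atomic_hull_single[OF this L1_boundedD(3)[OF A this], of 0] S show ?thesis
    by (auto intro: atomic_hull_mono)
qed

lemma atomic_hull_cmult:
  assumes f: "f \<in> atomic_hull M A S"
  shows "(\<lambda>x. z * f x) \<in> atomic_hull M A (norm z * S)"
proof -
  obtain l a where *: "f \<in> borel_measurable M" "\<And>j. a j \<in> A" "summable (\<lambda>j. norm (l j))"
    "(\<Sum>j. norm (l j)) \<le> S" "AE x in M. (\<lambda>j. l j * a j x) sums f x"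
    using f unfolding atomic_hull_def by blast
  show ?thesis
  proof (rule atomic_hullI[where l="\<lambda>j. z * l j" and a=a])
    show "(\<lambda>x. z * f x) \<in> borel_measurable M" using *(1) by measurable
    show "summable (\<lambda>j. norm (z * l j))"
      using *(3) by (simp add: norm_mult summable_mult)
    have "(\<Sum>j. norm (z * l j)) = norm z * (\<Sum>j. norm (l j))"
      using *(3) by (simp add: norm_mult suminf_mult)
    then show "(\<Sum>j. norm (z * l j)) \<le> norm z * S"
      using *(4) by (simp add: mult_left_mono)
    show "AE x in M. (\<lambda>j. z * l j * a j x) sums (z * f x)"
      using *(5) by eventually_elim (simp add: mult.assoc sums_mult)
  qed (use * in auto)
qed

text \<open>A series of series of atoms becomes a single series of atoms by enumerating the pairs of indices.
Almost everywhere the resulting double series converges absolutely, so its value does not depend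
on the order of summation and can be computed row by row.\<close>

lemma atomic_hull_sums:
  assumes A: "L1_bounded M L A"
    and f: "\<And>j. f j \<in> atomic_hull M A (S j)"
    and S: "summable S"
    and g: "g \<in> borel_measurable M" "AE x in M. (\<lambda>j. f j x) sums g x"
  shows "g \<in> atomic_hull M A (suminf S)"
proof -
  have "\<exists>l a. (\<forall>i. a i \<in> A) \<and> summable (\<lambda>i. norm (l i)) \<and> (\<Sum>i. norm (l i)) \<le> S j \<and>
       (AE x in M. (\<lambda>i. l i * a i x) sums f j x)" for j
    using f[of j] unfolding atomic_hull_def by blast
  then obtain l :: "nat \<Rightarrow> nat \<Rightarrow> complex" and a where
    a: "\<And>j i. a j i \<in> A" and l: "\<And>j. summable (\<lambda>i. norm (l j i))"
    and lS: "\<And>j. (\<Sum>i. norm (l j i)) \<le> S j"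
    and sums: "\<And>j. AE x in M. (\<lambda>i. l j i * a j i x) sums f j x"
    by metis
  let ?p = "prod_decode"
  define l' where "l' m = (case ?p m of (j, i) \<Rightarrow> l j i)" for m
  define a' where "a' m = (case ?p m of (j, i) \<Rightarrow> a j i)" for m
  have bij: "bij_betw ?p UNIV (UNIV \<times> UNIV)" using bij_prod_decode by simp
  have inner: "(\<lambda>i. norm (l j i)) summable_on UNIV" for j
    using l[of j] by (intro norm_summable_imp_summable_on) simp
  have inner_eq: "infsum (\<lambda>i. norm (l j i)) UNIV = (\<Sum>i. norm (l j i))" for j
    using l[of j] by (intro infsumI norm_summable_imp_has_sum) (auto simp: summable_sums)
  have sm: "summable (\<lambda>j. \<Sum>i. norm (l j i))"
    by (rule summable_comparison_test'[OF S]) (use lS suminf_nonneg[OF l] in auto)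
  have outer: "(\<lambda>j. \<Sum>i. norm (l j i)) summable_on UNIV"
    using sm by (intro norm_summable_imp_summable_on) (use suminf_nonneg[OF l] in auto)
  have abs: "(\<lambda>p. norm ((\<lambda>(j, i). l j i) p)) summable_on (UNIV \<times> UNIV)"
    unfolding Infinite_Sum.abs_summable_on_Sigma_iff
    using inner outer inner_eq suminf_nonneg[OF l] by (simp add: infsum_nonneg)
  have pair_eq: "norm (l' m) = (\<lambda>(j, i). norm (l j i)) (?p m)" for m
    by (simp add: l'_def split: prod.split)
  have abs': "(\<lambda>(j, i). norm (l j i)) summable_on (UNIV \<times> UNIV)"
    using abs by (simp add: case_prod_unfold)
  have "(\<lambda>m. norm (l' m)) summable_on UNIV"
    unfolding pair_eq using summable_on_reindex_bij_betw[OF bij, of "\<lambda>(j, i). norm (l j i)"] abs'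
    by simp
  then have l'_summable: "summable (\<lambda>m. norm (l' m))"
    by (rule summable_on_imp_summable)
  have "(\<Sum>m. norm (l' m)) = infsum (\<lambda>m. norm (l' m)) UNIV"
    using l'_summable by (intro infsumI[symmetric] norm_summable_imp_has_sum) (auto simp: summable_sums)
  also have "\<dots> = infsum (\<lambda>(j, i). norm (l j i)) (UNIV \<times> UNIV)"
    unfolding pair_eq by (rule infsum_reindex_bij_betw[OF bij])
  also have "\<dots> = infsum (\<lambda>j. infsum (\<lambda>i. norm (l j i)) UNIV) UNIV"
    using infsum_Sigma_banach[OF abs'] by simp
  also have "\<dots> = (\<Sum>j. \<Sum>i. norm (l j i))"
    unfolding inner_eq using sm suminf_nonneg[OF l]
    by (intro infsumI norm_summable_imp_has_sum) (auto simp: summable_sums)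
  also have "\<dots> \<le> suminf S"
    by (rule suminf_le[OF lS sm S])
  finally have l'_le: "(\<Sum>m. norm (l' m)) \<le> suminf S" .
  have a': "a' m \<in> A" for m using a by (simp add: a'_def split: prod.split)
  have "AE x in M. summable (\<lambda>m. norm (l' m * a' m x))"
    by (rule AE_summable_norm_if_summable_L1[where c="\<lambda>m. norm (l' m) * L"])
      (use a' l'_summable L1_boundedD[OF A] in \<open>auto intro: summable_mult2 borel_measurable_times\<close>)
  moreover have "AE x in M. \<forall>j. (\<lambda>i. l j i * a j i x) sums f j x"
    using sums by (simp add: AE_all_countable)
  ultimately have "AE x in M. (\<lambda>m. l' m * a' m x) sums g x"
    using g(2)
  proof eventually_elim
    case (elim x)
    let ?h = "\<lambda>(j, i). l j i * a j i x"
    have eq: "l' m * a' m x = ?h (?p m)" for m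
      by (simp add: l'_def a'_def split: prod.split)
    have "(\<lambda>m. norm (l' m * a' m x)) summable_on UNIV"
      using elim(1) by (intro norm_summable_imp_summable_on) simp
    then have h_abs: "(\<lambda>p. norm (?h p)) summable_on (UNIV \<times> UNIV)"
      unfolding eq using summable_on_reindex_bij_betw[OF bij, of "\<lambda>q. norm (?h q)"] by simp
    have hs: "((\<lambda>m. l' m * a' m x) has_sum (suminf (\<lambda>m. l' m * a' m x))) UNIV"
      using elim(1) by (intro norm_summable_imp_has_sum) (auto simp: summable_norm_cancel summable_sums)
    then have hsum: "(?h has_sum (suminf (\<lambda>m. l' m * a' m x))) (UNIV \<times> UNIV)"
      unfolding eq by (subst (asm) has_sum_reindex_bij_betw[OF bij])
    have fj: "((\<lambda>i. ?h (j, i)) has_sum f j x) UNIV" for j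
    proof -
      have "(\<lambda>i. norm (?h (j, i))) summable_on UNIV"
        using h_abs unfolding Infinite_Sum.abs_summable_on_Sigma_iff by auto
      then have "(\<lambda>i. norm (?h (j, i))) summable_on UNIV" by simp
      from summable_on_imp_summable[OF this] elim(2) show ?thesis
        by (intro norm_summable_imp_has_sum) auto
    qed
    have "((\<lambda>j. f j x) has_sum (suminf (\<lambda>m. l' m * a' m x))) UNIV"
      using has_sum_SigmaD[OF hsum, of "\<lambda>j. f j x"] fj by simp
    then have "(\<lambda>j. f j x) sums (suminf (\<lambda>m. l' m * a' m x))"
      by (rule has_sum_imp_sums)
    with elim(3) have "g x = suminf (\<lambda>m. l' m * a' m x)"
      by (rule sums_unique2)
    with elim(1) show ?case
      by (simp add: summable_norm_cancel summable_sums)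
  qed
  then show ?thesis
    by (intro atomic_hullI[where a=a' and l=l'] g a' l'_summable l'_le)
qed

lemma atomic_hull_suminf:
  assumes A: "L1_bounded M L A"
    and f: "\<And>j. f j \<in> atomic_hull M A (S j)"
    and S: "summable S"
  shows "(\<lambda>x. \<Sum>j. f j x) \<in> atomic_hull M A (suminf S)"
    and "AE x in M. (\<lambda>j. f j x) sums (\<Sum>j. f j x)"
proof -
  have m [measurable]: "f j \<in> borel_measurable M" for j using f by (rule atomic_hull_measurable)
  have "AE x in M. summable (\<lambda>j. norm (f j x))"
    by (rule AE_summable_norm_if_summable_L1[where c="\<lambda>j. S j * L"])
      (use atomic_hull_L1_bound[OF A f] atomic_hull_bound_nonneg[OF f] L1_boundedD(1)[OF A] S in
        \<open>auto intro: summable_mult2\<close>)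
  then show *: "AE x in M. (\<lambda>j. f j x) sums (\<Sum>j. f j x)"
    by eventually_elim (simp add: summable_norm_cancel summable_sums)
  show "(\<lambda>x. \<Sum>j. f j x) \<in> atomic_hull M A (suminf S)"
    by (rule atomic_hull_sums[OF A f S _ *]) measurable
qed

lemma atomic_hull_add:
  assumes A: "L1_bounded M L A" and f: "f \<in> atomic_hull M A S" and g: "g \<in> atomic_hull M A T"
  shows "(\<lambda>x. f x + g x) \<in> atomic_hull M A (S + T)"
proof -
  define h where "h j = (if j = 0 then f else if j = 1 then g else (\<lambda>x. 0))" for j :: nat
  define U where "U j = (if j = 0 then S else if j = 1 then T else 0)" for j :: nat
  have sums2: "(\<lambda>j. if j = 0 then p else if j = 1 then q else 0) sums (p + q)" for p q :: "'b::real_normed_vector"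
  proof -
    have "(\<lambda>j. if j = 0 then p else if j = 1 then q else 0) sums
        (\<Sum>j<2. (if j = (0::nat) then p else if j = 1 then q else 0))"
      by (rule sums_finite) auto
    then show ?thesis by (simp add: numeral_2_eq_2)
  qed
  have hU: "h j \<in> atomic_hull M A (U j)" for j
    using f g atomic_hull_zero[OF A, of 0] by (simp add: h_def U_def)
  have m [measurable]: "f \<in> borel_measurable M" "g \<in> borel_measurable M"
    using f g by (auto intro: atomic_hull_measurable)
  have U: "U sums (S + T)" unfolding U_def by (rule sums2)
  have "(\<lambda>x. f x + g x) \<in> atomic_hull M A (suminf U)"
  proof (rule atomic_hull_sums[OF A hU sums_summable[OF U]])
    have "(\<lambda>j. h j x) sums (f x + g x)" for x
      using sums2[of "f x" "g x"] by (simp add: h_def if_distribR cong: if_cong)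
    then show "AE x in M. (\<lambda>j. h j x) sums (f x + g x)" by simp
  qed measurable
  then show ?thesis by (simp only: sums_unique[OF U, symmetric])
qed

text \<open>If every atom in \<open>A\<close> is a combination of atoms in \<open>B\<close> up to an error of half its size, then
the error can be decomposed again. Applied to a combination of size \<open>S\<close>, the \<open>n\<close>-th repetition
contributes \<open>B\<close>-atoms of total size \<open>K * S / 2 ^ n\<close> and leaves a remainder of \<open>L\<^sup>1\<close> size
proportional to \<open>S / 2 ^ n\<close>. Thus the remainders vanish in the limit, and the sizes add up to
\<open>2 * K * S\<close>.\<close>

lemma atomic_hull_iterate:
  assumes A: "L1_bounded M L A" and B: "L1_bounded M L B"
    and step: "\<And>a. a \<in> A \<Longrightarrow> \<exists>u v. u \<in> atomic_hull M B K \<and> v \<in> atomic_hull M A (1/2) \<and>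
                 (AE x in M. a x = u x + v x)"
    and f: "f \<in> atomic_hull M A S"
  shows "f \<in> atomic_hull M B (2 * K * S)"
proof -
  have split: "\<exists>u v. u \<in> atomic_hull M B (K * T) \<and> v \<in> atomic_hull M A (T / 2) \<and>
                 (AE x in M. g x = u x + v x)" if g: "g \<in> atomic_hull M A T" for g T
  proof -
    obtain l a where *: "\<And>j. a j \<in> A" "summable (\<lambda>j. norm (l j))"
      "(\<Sum>j. norm (l j)) \<le> T" "AE x in M. (\<lambda>j. l j * a j x) sums g x"
      using g unfolding atomic_hull_def by blast
    obtain u v where uv: "\<And>j. u j \<in> atomic_hull M B K" "\<And>j. v j \<in> atomic_hull M A (1/2)"
      "\<And>j. AE x in M. a j x = u j x + v j x"
      using step[OF *(1)] by metis
    have K: "0 \<le> K" using uv(1) by (rule atomic_hull_bound_nonneg)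
    have u: "(\<lambda>x. l j * u j x) \<in> atomic_hull M B (norm (l j) * K)" for j
      by (rule atomic_hull_cmult[OF uv(1)])
    have v: "(\<lambda>x. l j * v j x) \<in> atomic_hull M A (norm (l j) * (1/2))" for j
      by (rule atomic_hull_cmult[OF uv(2)])
    note U = atomic_hull_suminf[OF B u summable_mult2[OF *(2)]]
    note V = atomic_hull_suminf[OF A v summable_mult2[OF *(2)]]
    have "AE x in M. \<forall>j. a j x = u j x + v j x"
      using uv(3) by (simp add: AE_all_countable)
    with U(2) V(2) *(4) have "AE x in M. g x = (\<Sum>j. l j * u j x) + (\<Sum>j. l j * v j x)"
    proof eventually_elim
      case (elim x)
      have "(\<lambda>j. l j * a j x) sums ((\<Sum>j. l j * u j x) + (\<Sum>j. l j * v j x))"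
        using sums_add[OF elim(1,2)] elim(4) by (simp add: distrib_left)
      with elim(3) show ?case by (rule sums_unique2)
    qed
    moreover have "(\<lambda>x. \<Sum>j. l j * u j x) \<in> atomic_hull M B (K * T)"
      using U(1)
    proof (rule atomic_hull_mono)
      have "(\<Sum>j. norm (l j) * K) = (\<Sum>j. norm (l j)) * K"
        using *(2) by (rule suminf_mult2[symmetric])
      also have "\<dots> \<le> T * K"
        using *(3) K by (rule mult_right_mono)
      finally show "(\<Sum>j. norm (l j) * K) \<le> K * T"
        by (simp only: mult.commute)
    qed
    moreover have "(\<lambda>x. \<Sum>j. l j * v j x) \<in> atomic_hull M A (T / 2)"
      using V(1) by (rule atomic_hull_mono) (use *(2,3) in \<open>simp add: suminf_divide\<close>)
    ultimately show ?thesis by blast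
  qed
  define P where "P n g \<longleftrightarrow> g \<in> atomic_hull M A (S / 2 ^ n)" for n :: nat and g
  have "\<exists>F. \<forall>n. (P n (F n) \<and> (n = 0 \<longrightarrow> F n = f)) \<and>
     (\<exists>u. u \<in> atomic_hull M B (K * (S / 2 ^ n)) \<and> (AE x in M. F n x = u x + F (Suc n) x))"
  proof (rule dependent_nat_choice)
    show "\<exists>g. P 0 g \<and> (0 = (0::nat) \<longrightarrow> g = f)" using f by (auto simp: P_def)
  next
    fix g and n :: nat assume "P n g \<and> (n = 0 \<longrightarrow> g = f)"
    then have "g \<in> atomic_hull M A (S / 2 ^ n)" by (simp add: P_def)
    from split[OF this] obtain u v where uv: "u \<in> atomic_hull M B (K * (S / 2 ^ n))"
      "v \<in> atomic_hull M A (S / 2 ^ n / 2)" "AE x in M. g x = u x + v x" by blast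
    have "P (Suc n) v" using uv(2) by (simp add: P_def mult.commute)
    with uv(1,3) show "\<exists>h. (P (Suc n) h \<and> (Suc n = 0 \<longrightarrow> h = f)) \<and>
        (\<exists>u. u \<in> atomic_hull M B (K * (S / 2 ^ n)) \<and> (AE x in M. g x = u x + h x))"
      by blast
  qed
  then obtain F where F': "\<And>n. P n (F n)" "\<And>n. n = 0 \<Longrightarrow> F n = f"
    and "\<And>n. \<exists>u. u \<in> atomic_hull M B (K * (S / 2 ^ n)) \<and> (AE x in M. F n x = u x + F (Suc n) x)"
    by blast
  then obtain u where u: "\<And>n. u n \<in> atomic_hull M B (K * (S / 2 ^ n))"
    and FS: "\<And>n. AE x in M. F n x = u n x + F (Suc n) x"
    by metis
  have F: "\<And>n. F n \<in> atomic_hull M A (S / 2 ^ n)" "F 0 = f"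
    using F' by (auto simp: P_def)
  have S0: "0 \<le> S" using f by (rule atomic_hull_bound_nonneg)
  have geo: "(\<lambda>n. S / 2 ^ n) sums (2 * S)"
  proof -
    have "(\<lambda>n. S * (1 / 2) ^ n) sums (S * (1 / (1 - 1 / 2)))"
      by (intro sums_mult geometric_sums) simp
    then show ?thesis by (simp add: power_one_over mult.commute)
  qed
  have "AE x in M. summable (\<lambda>n. norm (F n x))"
    by (rule AE_summable_norm_if_summable_L1[where c="\<lambda>n. S / 2 ^ n * L"])
      (use atomic_hull_L1_bound[OF A F(1)] atomic_hull_measurable[OF F(1)] S0 L1_boundedD(1)[OF A]
         summable_mult2[OF sums_summable[OF geo], of L] in auto)
  moreover have "AE x in M. \<forall>n. F n x = u n x + F (Suc n) x"
    using FS by (simp add: AE_all_countable)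
  ultimately have "AE x in M. (\<lambda>n. u n x) sums f x"
  proof eventually_elim
    case (elim x)
    have *: "(\<Sum>n<N. u n x) = f x - F N x" for N
    proof (induction N)
      case (Suc N)
      then show ?case using elim(2)[rule_format, of N] by simp
    qed (simp add: F)
    have "(\<lambda>N. F N x) \<longlonglongrightarrow> 0"
      using summable_LIMSEQ_zero[OF elim(1)] by (simp add: tendsto_norm_zero_iff)
    then have "(\<lambda>N. f x - F N x) \<longlonglongrightarrow> f x - 0"
      by (intro tendsto_intros)
    then show ?case by (simp add: sums_def *)
  qed
  then have "f \<in> atomic_hull M B (\<Sum>n. K * (S / 2 ^ n))"
    by (intro atomic_hull_sums[OF B u] atomic_hull_measurable[OF f] summable_mult sums_summable[OF geo])
  also have "(\<Sum>n. K * (S / 2 ^ n)) = 2 * K * S"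
    using sums_unique[OF sums_mult[OF geo, of K]] by simp
  finally show ?thesis .
qed

text \<open>The \<open>L\<^sup>1\<close> distance from a pointwise sum to its partial sums is at most the tail of the
coefficient series, which tends to zero. Conversely the pointwise sum exists almost everywhere and
is itself an \<open>L\<^sup>1\<close> limit, so it agrees with any other \<open>L\<^sup>1\<close> limit.\<close>

lemma L1_limit_iff_AE_sums:
  assumes A: "L1_bounded M L A" and a: "\<And>j. a j \<in> A" and l: "summable (\<lambda>j. norm (l j))"
    and f: "f \<in> borel_measurable M"
  shows "(\<lambda>N. \<integral>\<^sup>+x. ennreal (norm (f x - (\<Sum>j<N. l j * a j x))) \<partial>M) \<longlonglongrightarrow> 0 \<longleftrightarrow>
    (AE x in M. (\<lambda>j. l j * a j x) sums f x)"
proof -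
  have m [measurable]: "a j \<in> borel_measurable M" for j using L1_boundedD(3)[OF A a] .
  have f' [measurable]: "f \<in> borel_measurable M" by (rule f)
  let ?c = "\<lambda>j. norm (l j) * L"
  have c: "summable ?c" "\<And>j. 0 \<le> ?c j" using l L1_boundedD(1)[OF A] by (auto intro: summable_mult2)
  have backward: "(\<lambda>N. \<integral>\<^sup>+x. ennreal (norm (g x - (\<Sum>j<N. l j * a j x))) \<partial>M) \<longlonglongrightarrow> 0"
    if g: "AE x in M. (\<lambda>j. l j * a j x) sums g x" for g
  proof (rule tendsto_sandwich[OF _ _ tendsto_const])
    show "\<forall>\<^sub>F N in sequentially. (\<integral>\<^sup>+x. ennreal (norm (g x - (\<Sum>j<N. l j * a j x))) \<partial>M)
        \<le> ennreal (\<Sum>j. ?c (j + N))"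
    proof (rule always_eventually, rule allI)
      fix N
      show "(\<integral>\<^sup>+x. ennreal (norm (g x - (\<Sum>j<N. l j * a j x))) \<partial>M) \<le> ennreal (\<Sum>j. ?c (j + N))"
      proof (rule nn_integral_norm_sums_le[where f="\<lambda>j x. l (j + N) * a (j + N) x"])
        show "AE x in M. (\<lambda>j. l (j + N) * a (j + N) x) sums (g x - (\<Sum>j<N. l j * a j x))"
          using g by eventually_elim (rule sums_split_initial_segment)
        show "summable (\<lambda>j. ?c (j + N))"
          using c(1) by (rule summable_ignore_initial_segment)
      qed (use L1_boundedD(5)[OF A a] c(2) in \<open>auto\<close>)
    qed
    have "(\<lambda>N. suminf ?c - (\<Sum>j<N. ?c j)) \<longlonglongrightarrow> suminf ?c - suminf ?c"
      by (intro tendsto_intros summable_LIMSEQ c(1))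
    then have "(\<lambda>N. \<Sum>j. ?c (j + N)) \<longlonglongrightarrow> 0"
      by (simp add: suminf_minus_initial_segment[OF c(1)])
    then show "(\<lambda>N. ennreal (\<Sum>j. ?c (j + N))) \<longlonglongrightarrow> 0"
      using tendsto_ennrealI by fastforce
  qed simp
  show ?thesis
  proof
    assume lim: "(\<lambda>N. \<integral>\<^sup>+x. ennreal (norm (f x - (\<Sum>j<N. l j * a j x))) \<partial>M) \<longlonglongrightarrow> 0"
    define g where "g x = (\<Sum>j. l j * a j x)" for x
    have g_m [measurable]: "g \<in> borel_measurable M" unfolding g_def by measurable
    have "AE x in M. summable (\<lambda>j. norm (l j * a j x))"
      by (rule AE_summable_norm_if_summable_L1[where c="?c"]) (use L1_boundedD(5)[OF A a] c in auto)
    then have g: "AE x in M. (\<lambda>j. l j * a j x) sums g x"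
      unfolding g_def by eventually_elim (simp add: summable_norm_cancel summable_sums)
    have le: "(\<integral>\<^sup>+x. ennreal (norm (f x - g x)) \<partial>M) \<le>
        (\<integral>\<^sup>+x. ennreal (norm (f x - (\<Sum>j<N. l j * a j x))) \<partial>M) +
        (\<integral>\<^sup>+x. ennreal (norm (g x - (\<Sum>j<N. l j * a j x))) \<partial>M)" for N
    proof -
      have "(\<integral>\<^sup>+x. ennreal (norm (f x - g x)) \<partial>M) \<le>
        (\<integral>\<^sup>+x. ennreal (norm (f x - (\<Sum>j<N. l j * a j x))) + ennreal (norm (g x - (\<Sum>j<N. l j * a j x))) \<partial>M)"
      proof (rule nn_integral_mono)
        fix x
        show "ennreal (norm (f x - g x)) \<le> ennreal (norm (f x - (\<Sum>j<N. l j * a j x))) +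
            ennreal (norm (g x - (\<Sum>j<N. l j * a j x)))"
          using norm_triangle_ineq4[of "f x - (\<Sum>j<N. l j * a j x)" "g x - (\<Sum>j<N. l j * a j x)"]
          by (simp add: ennreal_plus[symmetric] del: ennreal_plus)
      qed
      also have "\<dots> = (\<integral>\<^sup>+x. ennreal (norm (f x - (\<Sum>j<N. l j * a j x))) \<partial>M) +
          (\<integral>\<^sup>+x. ennreal (norm (g x - (\<Sum>j<N. l j * a j x))) \<partial>M)"
        by (rule nn_integral_add) measurable
      finally show ?thesis .
    qed
    have "(\<integral>\<^sup>+x. ennreal (norm (f x - g x)) \<partial>M) \<le> 0 + 0"
      by (rule LIMSEQ_le_const[OF tendsto_add[OF lim backward[OF g]]]) (use le in auto)
    then have "AE x in M. ennreal (norm (f x - g x)) = 0"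
      by (subst nn_integral_0_iff_AE[symmetric]) auto
    with g show "AE x in M. (\<lambda>j. l j * a j x) sums f x"
      by eventually_elim simp
  qed (rule backward)
qed

section \<open>The Gauss measure and its atoms\<close>

definition gauss_density :: "'a::euclidean_space \<Rightarrow> real" where
  "gauss_density x = pi powr (- real DIM('a) / 2) * exp (- (norm x)\<^sup>2)"

lemma gauss_density_pos: "0 < gauss_density x"
  by (simp add: gauss_density_def)

lemma gauss_density_measurable [measurable]: "gauss_density \<in> borel_measurable borel"
  unfolding gauss_density_def by measurable

lemma gauss_eq: "gauss = density lborel (\<lambda>x. ennreal (gauss_density x))"
  by (simp add: gauss_def gauss_density_def)

lemma sets_gauss [simp, measurable_cong]: "sets gauss = sets borel"
  by (simp add: gauss_def)

lemma space_gauss [simp]: "space gauss = UNIV"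
  by (simp add: gauss_def)

lemma borel_measurable_gauss [simp]: "borel_measurable gauss = borel_measurable borel"
  by (rule measurable_cong_sets) simp_all

text \<open>The one-dimensional factor \<open>exp (- t\<^sup>2) / sqrt pi\<close> is the normal density of variance \<open>1/2\<close>, which
gives the total mass of the Gauss measure.\<close>

lemma gauss_density_prod: "gauss_density x = (\<Prod>b\<in>Basis. normal_density 0 (sqrt (1/2)) (x \<bullet> b))"
  for x :: "'a::euclidean_space"
proof -
  have "normal_density 0 (sqrt (1/2)) t = pi powr (-1/2) * exp (- t\<^sup>2)" for t
    by (simp add: normal_density_def powr_minus powr_half_sqrt field_simps)
  then have "(\<Prod>b\<in>Basis. normal_density 0 (sqrt (1/2)) (x \<bullet> b)) =
      (\<Prod>b\<in>(Basis::'a set). pi powr (-1/2)) * (\<Prod>b\<in>Basis. exp (- (x \<bullet> b)\<^sup>2))"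
    by (simp only: prod.distrib)
  also have "(\<Prod>b\<in>Basis. exp (- (x \<bullet> b)\<^sup>2)) = exp (- (norm x)\<^sup>2)"
  proof -
    have "(norm x)\<^sup>2 = (\<Sum>b\<in>Basis. (x \<bullet> b)\<^sup>2)"
      by (subst power2_norm_eq_inner, subst euclidean_inner) (simp add: power2_eq_square)
    then show ?thesis by (simp add: exp_sum[symmetric] sum_negf)
  qed
  also have "(\<Prod>b\<in>(Basis::'a set). pi powr (-1/2)) = pi powr (- real DIM('a) / 2)"
    by (simp add: powr_powr powr_realpow[symmetric])
  finally show ?thesis by (simp add: gauss_density_def)
qed

lemma prob_space_gauss: "prob_space (gauss :: 'a::euclidean_space measure)"
proof
  interpret N: prob_space "density lborel (normal_density 0 (sqrt (1/2)))"
    by (rule prob_space_normal_density) simp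
  have one: "(\<integral>\<^sup>+t. ennreal (normal_density 0 (sqrt (1/2)) t) \<partial>lborel) = 1"
    using N.emeasure_space_1 by (simp add: emeasure_density)
  have "emeasure (gauss :: 'a measure) (space gauss) = (\<integral>\<^sup>+x. ennreal (gauss_density (x :: 'a)) \<partial>lborel)"
    by (simp add: gauss_eq emeasure_density)
  also have "\<dots> = (\<integral>\<^sup>+x. (\<Prod>b\<in>Basis. ennreal (normal_density 0 (sqrt (1/2)) ((x :: 'a) \<bullet> b))) \<partial>lborel)"
    by (simp add: gauss_density_prod prod_ennreal)
  also have "\<dots> = (\<Prod>b\<in>(Basis :: 'a set). \<integral>\<^sup>+t. ennreal (normal_density 0 (sqrt (1/2)) t) \<partial>lborel)"
    by (rule nn_integral_lborel_prod) auto
  finally show "emeasure (gauss :: 'a measure) (space gauss) = 1" using one by simp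
qed

lemma gauss_measure_bounds:
  assumes S: "S \<in> sets borel" "bounded S" and d: "\<And>x. x \<in> S \<Longrightarrow> lo \<le> gauss_density x \<and> gauss_density x \<le> hi"
    and lo: "0 \<le> lo" "0 \<le> hi"
  shows "lo * measure lborel S \<le> measure gauss S" "measure gauss S \<le> hi * measure lborel S"
proof -
  interpret prob_space gauss by (rule prob_space_gauss)
  have fin: "emeasure lborel S < \<infinity>" using S emeasure_bounded_finite by auto
  have em: "emeasure lborel S = ennreal (measure lborel S)"
    using fin by (intro emeasure_eq_ennreal_measure) auto
  have eg: "ennreal (measure gauss S) = (\<integral>\<^sup>+x. ennreal (gauss_density x) * indicator S x \<partial>lborel)"
    using S by (subst emeasure_eq_measure[symmetric], subst gauss_eq, subst emeasure_density) auto
  have "(\<integral>\<^sup>+x. ennreal lo * indicator S x \<partial>lborel) \<le> (\<integral>\<^sup>+x. ennreal (gauss_density x) * indicator S x \<partial>lborel)"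
    by (intro nn_integral_mono) (use d in \<open>auto simp: indicator_def ennreal_leI\<close>)
  then have "ennreal (lo * measure lborel S) \<le> ennreal (measure gauss S)"
    using S lo by (simp add: eg nn_integral_cmult_indicator em ennreal_mult)
  then show "lo * measure lborel S \<le> measure gauss S" by simp
  have "(\<integral>\<^sup>+x. ennreal (gauss_density x) * indicator S x \<partial>lborel) \<le> (\<integral>\<^sup>+x. ennreal hi * indicator S x \<partial>lborel)"
    by (intro nn_integral_mono) (use d in \<open>auto simp: indicator_def ennreal_leI\<close>)
  then have "ennreal (measure gauss S) \<le> ennreal (hi * measure lborel S)"
    using S lo by (simp add: eg nn_integral_cmult_indicator em ennreal_mult)
  then show "measure gauss S \<le> hi * measure lborel S" using lo by simp
qed

lemma measure_gauss_cball_pos: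
  assumes "0 < R" shows "0 < measure gauss (cball (c :: 'a::euclidean_space) R)"
proof -
  let ?lo = "pi powr (- real DIM('a) / 2) * exp (- (norm c + R)\<^sup>2)"
  let ?hi = "pi powr (- real DIM('a) / 2)"
  have "?lo * measure lborel (cball c R) \<le> measure gauss (cball c R)"
  proof (rule gauss_measure_bounds(1)[where hi="?hi"])
    fix x assume "x \<in> cball c R"
    then have "norm x \<le> norm c + R"
      using norm_triangle_sub[of x c] by (simp add: dist_norm norm_minus_commute)
    then have "(norm x)\<^sup>2 \<le> (norm c + R)\<^sup>2" by (intro power_mono) auto
    then show "?lo \<le> gauss_density x \<and> gauss_density x \<le> ?hi"
      by (simp add: gauss_density_def)
  qed auto
  moreover have "0 < measure lborel (cball c R)"
    using content_cball_pos[OF assms, of c] by simp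
  ultimately show ?thesis
    by (smt (verit) exp_gt_zero mult_pos_pos pi_gt_zero powr_gt_zero)
qed

lemma admissible_ballD:
  assumes "admissible_ball B"
  shows "0 < measure gauss B" "B \<in> sets borel"
  using assms by (auto simp: admissible_ball_def measure_gauss_cball_pos)

text \<open>The essential supremum is an extended real which could only be negative on a space of measure zero,
so the norm condition is an ordinary almost everywhere bound.\<close>

lemma gauss_atom_infinity_iff:
  fixes a :: "'a::euclidean_space \<Rightarrow> complex"
  shows "gauss_atom \<infinity> a \<longleftrightarrow> a = (\<lambda>_. 1) \<or> (a \<in> borel_measurable borel \<and>
     (\<exists>B. admissible_ball B \<and> (AE x in gauss. x \<notin> B \<longrightarrow> a x = 0) \<and> (\<integral>x. a x \<partial>gauss) = 0 \<and>
       (AE x in gauss. norm (a x) \<le> 1 / measure gauss B)))"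
proof -
  interpret prob_space "gauss :: 'a measure" by (rule prob_space_gauss)
  let ?e = "esssup gauss (\<lambda>x. ereal (norm (a x)))"
  have key: "(?e < \<infinity> \<and> real_of_ereal ?e \<le> measure gauss B powr - 1) \<longleftrightarrow>
      (AE x in gauss. norm (a x) \<le> 1 / measure gauss B)"
    if a: "a \<in> borel_measurable borel" and B: "admissible_ball B" for B
  proof -
    have pw: "measure gauss B powr - 1 = 1 / measure gauss B"
      using admissible_ballD[OF B] by (simp add: powr_minus field_simps)
    have AE: "AE x in gauss. ereal (norm (a x)) \<le> ?e" by (rule esssup_AE)
    have "0 \<le> ?e"
    proof (rule ccontr)
      assume "\<not> 0 \<le> ?e"
      from AE have "AE x in (gauss :: 'a measure). False"
      proof (rule eventually_mono)
        fix x assume "ereal (norm (a x)) \<le> ?e"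
        moreover have "0 \<le> ereal (norm (a x))" by simp
        ultimately show False using \<open>\<not> 0 \<le> ?e\<close> by (meson order_trans)
      qed
      then show False by simp
    qed
    then have e: "?e = \<infinity> \<or> ?e = ereal (real_of_ereal ?e)" by (cases ?e) auto
    show ?thesis
    proof
      assume *: "?e < \<infinity> \<and> real_of_ereal ?e \<le> measure gauss B powr - 1"
      with e have eq: "?e = ereal (real_of_ereal ?e)" by auto
      from AE show "AE x in gauss. norm (a x) \<le> 1 / measure gauss B"
      proof eventually_elim
        case (elim x)
        then have "ereal (norm (a x)) \<le> ereal (real_of_ereal ?e)" using eq by simp
        then show ?case using * pw by simp
      qed
    next
      assume "AE x in gauss. norm (a x) \<le> 1 / measure gauss B"
      then have "?e \<le> ereal (1 / measure gauss B)"
        using a by (intro esssup_I) auto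
      with e pw show "?e < \<infinity> \<and> real_of_ereal ?e \<le> measure gauss B powr - 1"
        by (cases ?e) auto
    qed
  qed
  have "gauss_atom \<infinity> a \<longleftrightarrow> a = (\<lambda>_. 1) \<or> ((a \<in> borel_measurable borel \<and> ?e < \<infinity>) \<and>
     (\<exists>B. admissible_ball B \<and> (AE x in gauss. x \<notin> B \<longrightarrow> a x = 0) \<and> (\<integral>x. a x \<partial>gauss) = 0 \<and>
       real_of_ereal ?e \<le> measure gauss B powr - 1))"
    by (simp add: gauss_atom_def Lr_space_def Lr_norm_def)
  also have "\<dots> \<longleftrightarrow> a = (\<lambda>_. 1) \<or> (a \<in> borel_measurable borel \<and>
     (\<exists>B. admissible_ball B \<and> (AE x in gauss. x \<notin> B \<longrightarrow> a x = 0) \<and> (\<integral>x. a x \<partial>gauss) = 0 \<and>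
       (AE x in gauss. norm (a x) \<le> 1 / measure gauss B)))"
    using key by blast
  finally show ?thesis .
qed

lemma gauss_atom_real_iff:
  assumes p: "1 < p"
  shows "gauss_atom (ereal p) a \<longleftrightarrow> a = (\<lambda>_. 1) \<or> (a \<in> borel_measurable borel \<and>
     integrable gauss (\<lambda>x. norm (a x) powr p) \<and>
     (\<exists>B. admissible_ball B \<and> (AE x in gauss. x \<notin> B \<longrightarrow> a x = 0) \<and> (\<integral>x. a x \<partial>gauss) = 0 \<and>
       (\<integral>x. norm (a x) powr p \<partial>gauss) \<le> measure gauss B powr (1 - p)))"
proof -
  have key: "((\<integral>x. norm (a x) powr p \<partial>gauss) powr (1 / p) \<le> measure gauss B powr (1 / p - 1)) \<longleftrightarrow>
      (\<integral>x. norm (a x) powr p \<partial>gauss) \<le> measure gauss B powr (1 - p)" if "admissible_ball B" for B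
  proof -
    let ?I = "\<integral>x. norm (a x) powr p \<partial>gauss" and ?m = "measure gauss B"
    have I: "0 \<le> ?I" by (intro integral_nonneg_AE) auto
    have "?m powr (1 / p - 1) = (?m powr (1 - p)) powr (1 / p)"
      using p by (simp add: powr_powr field_simps)
    moreover have "?I powr (1 / p) \<le> (?m powr (1 - p)) powr (1 / p) \<longleftrightarrow> ?I \<le> ?m powr (1 - p)"
      using p I by (smt (verit) divide_pos_pos powr_ge_zero powr_less_mono2 powr_mono2)
    ultimately show ?thesis by simp
  qed
  have "gauss_atom (ereal p) a \<longleftrightarrow> a = (\<lambda>_. 1) \<or> ((a \<in> borel_measurable borel \<and>
     integrable gauss (\<lambda>x. norm (a x) powr p)) \<and>
     (\<exists>B. admissible_ball B \<and> (AE x in gauss. x \<notin> B \<longrightarrow> a x = 0) \<and> (\<integral>x. a x \<partial>gauss) = 0 \<and>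
       (\<integral>x. norm (a x) powr p \<partial>gauss) powr (1 / p) \<le> measure gauss B powr (1 / p - 1)))"
    using p by (simp add: gauss_atom_def Lr_space_def Lr_norm_def one_ereal_def)
  then show ?thesis
    using key by blast
qed

text \<open>This replaces Hoelder's inequality: an average of \<open>norm a powr p\<close> of order \<open>T powr p\<close> forces an
average of \<open>norm a\<close> of order \<open>T\<close>.\<close>

lemma powr_interpolation:
  fixes t T p :: real
  assumes "0 \<le> t" "0 < T" "1 < p"
  shows "t \<le> T + T powr (1 - p) * t powr p"
proof (cases "t \<le> T")
  case False
  then have "T powr (1 - p) * t powr p = t * (t / T) powr (p - 1)"
    using assms by (simp add: powr_divide powr_diff field_simps)
  moreover have "1 \<le> (t / T) powr (p - 1)"
    using False assms by (intro ge_one_powr_ge_zero) auto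
  ultimately have "t * 1 \<le> T powr (1 - p) * t powr p"
    using assms(1) by (metis mult_left_mono)
  then show ?thesis
    using assms(2) by simp
qed (use assms in \<open>simp add: add_increasing2\<close>)

lemma gauss_atom_infinity_imp_real:
  assumes p: "1 < p" and a: "gauss_atom \<infinity> a"
  shows "gauss_atom (ereal p) a"
proof (cases "a = (\<lambda>_. 1)")
  case True then show ?thesis by (simp add: gauss_atom_def)
next
  case False
  interpret prob_space gauss by (rule prob_space_gauss)
  from a False obtain B where m [measurable]: "a \<in> borel_measurable borel" and B: "admissible_ball B"
    "AE x in gauss. x \<notin> B \<longrightarrow> a x = 0" "(\<integral>x. a x \<partial>gauss) = 0"
    "AE x in gauss. norm (a x) \<le> 1 / measure gauss B"
    unfolding gauss_atom_infinity_iff by blast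
  let ?m = "measure gauss B"
  note B' = admissible_ballD[OF B(1)]
  have le: "AE x in gauss. norm (a x) powr p \<le> (1 / ?m) powr p * indicator B x"
    using B(2,4)
  proof eventually_elim
    case (elim x)
    then show ?case using p powr_mono2[of p "norm (a x)" "1 / ?m"] by (cases "x \<in> B") auto
  qed
  have int: "integrable gauss (\<lambda>x. (1 / ?m) powr p * indicator B x)"
    using B'(2) by (intro integrable_mult_right integrable_real_indicator) (auto simp: emeasure_eq_measure)
  have i: "integrable gauss (\<lambda>x. norm (a x) powr p)"
    by (rule Bochner_Integration.integrable_bound[OF int])
      (use m le in \<open>auto elim!: eventually_mono\<close>)
  have "(\<integral>x. norm (a x) powr p \<partial>gauss) \<le> (\<integral>x. (1 / ?m) powr p * indicator B x \<partial>gauss)"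
    by (rule integral_mono_AE[OF i int le])
  also have "\<dots> = (1 / ?m) powr p * ?m" using B'(2) by simp
  also have "\<dots> = ?m powr (1 - p)"
    using B'(1) by (simp add: powr_divide powr_diff)
  finally show ?thesis
    unfolding gauss_atom_real_iff[OF p] using i m B by blast
qed

lemma L1_bounded_gauss_atoms_real:
  assumes p: "1 < p"
  shows "L1_bounded gauss 2 {a :: 'a::euclidean_space \<Rightarrow> complex. gauss_atom (ereal p) a}"
proof -
  interpret prob_space "gauss :: 'a measure" by (rule prob_space_gauss)
  have "a \<in> borel_measurable borel \<and> (\<integral>\<^sup>+x. ennreal (norm (a x)) \<partial>gauss) \<le> ennreal 2"
    if a: "gauss_atom (ereal p) a" for a :: "'a \<Rightarrow> complex"
  proof (cases "a = (\<lambda>_. 1)")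
    case True
    then show ?thesis using emeasure_space_1 by simp
  next
    case False
    from a False obtain B where m [measurable]: "a \<in> borel_measurable borel"
      and i: "integrable gauss (\<lambda>x. norm (a x) powr p)" and B: "admissible_ball B"
      "AE x in gauss. x \<notin> B \<longrightarrow> a x = 0"
      "(\<integral>x. norm (a x) powr p \<partial>gauss) \<le> measure gauss B powr (1 - p)"
      unfolding gauss_atom_real_iff[OF p] by blast
    note B' = admissible_ballD[OF B(1)]
    \<comment> \<open>the height of an atom of exponent \<open>\<infinity>\<close>: each summand in the interpolation then has integral at most 1\<close>
    let ?T = "1 / measure gauss B"
    have T: "0 < ?T" using B'(1) by simp
    have intB: "integrable gauss (\<lambda>x. ?T * indicator B x)"
      using B'(2) by (intro integrable_mult_right integrable_real_indicator) (auto simp: emeasure_eq_measure)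
    note int = Bochner_Integration.integrable_add[OF intB integrable_mult_right[OF i, of "?T powr (1 - p)"]]
    have "AE x in gauss. norm (a x) \<le> ?T * indicator B x + ?T powr (1 - p) * norm (a x) powr p"
      using B(2)
    proof eventually_elim
      case (elim x)
      then show ?case using powr_interpolation[OF norm_ge_zero T p, of "a x"] by (cases "x \<in> B") auto
    qed
    then have "(\<integral>\<^sup>+x. ennreal (norm (a x)) \<partial>gauss) \<le>
        (\<integral>\<^sup>+x. ennreal (?T * indicator B x + ?T powr (1 - p) * norm (a x) powr p) \<partial>gauss)"
      by (intro nn_integral_mono_AE) (auto elim!: eventually_mono intro!: ennreal_leI simp del: ennreal_plus)
    also have "\<dots> = ennreal (\<integral>x. ?T * indicator B x + ?T powr (1 - p) * norm (a x) powr p \<partial>gauss)"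
      by (rule nn_integral_eq_integral[OF int]) (use T in auto)
    also have "(\<integral>x. ?T * indicator B x + ?T powr (1 - p) * norm (a x) powr p \<partial>gauss) =
        ?T * measure gauss B + ?T powr (1 - p) * (\<integral>x. norm (a x) powr p \<partial>gauss)"
      using B'(2) by (subst Bochner_Integration.integral_add[OF intB integrable_mult_right[OF i]]) simp
    also have "\<dots> \<le> ?T * measure gauss B + ?T powr (1 - p) * measure gauss B powr (1 - p)"
      using B(3) by (intro add_left_mono mult_left_mono) auto
    also have "\<dots> = 2"
      using B'(1) by (simp add: powr_divide)
    finally show ?thesis using m by (simp add: ennreal_leI)
  qed
  moreover have "gauss_atom (ereal p) (\<lambda>_ :: 'a. 1)" by (simp add: gauss_atom_def)
  ultimately show ?thesis unfolding L1_bounded_def by auto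
qed

lemma L1_bounded_gauss_atoms_infinity:
  "L1_bounded gauss 2 {a :: 'a::euclidean_space \<Rightarrow> complex. gauss_atom \<infinity> a}"
proof -
  have "gauss_atom \<infinity> (\<lambda>_ :: 'a. 1)" by (simp add: gauss_atom_def)
  then show ?thesis
    using L1_bounded_gauss_atoms_real[of 2, where ?'a='a]
      gauss_atom_infinity_imp_real[of 2, where ?'a='a]
    unfolding L1_bounded_def by (metis (mono_tags, lifting) empty_iff mem_Collect_eq one_less_numeral_iff semiring_norm(76))
qed

text \<open>The radius \<open>\<kappa> * V\<close> records what a function of height \<open>\<kappa>\<close> living on a set of measure \<open>V\<close> costs.
It suffices that \<open>V\<close> dominates the measure of the supporting ball, because the exponent \<open>1 - p\<close> in
the size condition of atoms is negative.\<close>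

lemma atomic_hull_real_atomI:
  assumes p: "1 < p" and h: "h \<in> borel_measurable borel" and F: "admissible_ball F"
    and supp: "AE x in gauss. x \<notin> F \<longrightarrow> h x = 0" and mean: "(\<integral>x. h x \<partial>gauss) = 0"
    and int: "integrable gauss (\<lambda>x. norm (h x) powr p)"
    and le: "(\<integral>x. norm (h x) powr p \<partial>gauss) \<le> \<kappa> powr p * V" and V: "measure gauss F \<le> V" and \<kappa>: "0 < \<kappa>"
  shows "h \<in> atomic_hull gauss {a. gauss_atom (ereal p) a} (\<kappa> * V)"
proof -
  note F' = admissible_ballD[OF F]
  have V0: "0 < V" using F' V by simp
  let ?z = "\<kappa> * V"
  have z: "0 < ?z" using \<kappa> V0 by simp
  have nz: "norm (h x / complex_of_real ?z) powr p = ?z powr (- p) * norm (h x) powr p" for x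
  proof -
    have "norm (h x / complex_of_real ?z) = norm (h x) / ?z"
      using z by (simp add: norm_divide del: of_real_mult)
    then show ?thesis using z by (simp add: powr_divide powr_minus field_simps)
  qed
  have "gauss_atom (ereal p) (\<lambda>x. h x / ?z)"
    unfolding gauss_atom_real_iff[OF p]
  proof (intro disjI2 conjI exI)
    show "(\<lambda>x. h x / ?z) \<in> borel_measurable borel" using h by measurable
    show "integrable gauss (\<lambda>x. norm (h x / ?z) powr p)"
      unfolding nz using int by (rule integrable_mult_right)
    show "admissible_ball F" by (rule F)
    show "AE x in gauss. x \<notin> F \<longrightarrow> h x / ?z = 0" using supp by eventually_elim auto
    show "(\<integral>x. h x / ?z \<partial>gauss) = 0" using mean by (subst integral_divide_zero) simp
    have "(\<integral>x. norm (h x / ?z) powr p \<partial>gauss) = ?z powr (- p) * (\<integral>x. norm (h x) powr p \<partial>gauss)"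
      unfolding nz by (rule integral_mult_right_zero)
    also have "\<dots> \<le> ?z powr (- p) * (\<kappa> powr p * V)"
      using le by (intro mult_left_mono) auto
    also have "\<dots> = V powr (1 - p)"
      using \<kappa> V0 by (simp add: powr_mult powr_minus powr_diff field_simps)
    also have "\<dots> \<le> measure gauss F powr (1 - p)"
      using F'(1) V p by (intro powr_mono2') auto
    finally show "(\<integral>x. norm (h x / ?z) powr p \<partial>gauss) \<le> measure gauss F powr (1 - p)" .
  qed
  then have "(\<lambda>x. complex_of_real ?z * (h x / ?z)) \<in> atomic_hull gauss {a. gauss_atom (ereal p) a} (norm (complex_of_real ?z))"
    by (intro atomic_hull_single) (use h in simp_all)
  moreover have "(\<lambda>x. complex_of_real ?z * (h x / ?z)) = h"
    using V0 \<kappa> by (intro ext) simp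
  moreover have "norm (complex_of_real ?z) = ?z"
    using z by (simp del: of_real_mult)
  ultimately show ?thesis by simp
qed

lemma atomic_hull_infinity_atomI:
  assumes h: "h \<in> borel_measurable borel" and F: "admissible_ball F"
    and supp: "AE x in gauss. x \<notin> F \<longrightarrow> h x = 0" and mean: "(\<integral>x. h x \<partial>gauss) = 0"
    and le: "AE x in gauss. norm (h x) \<le> \<kappa>" and V: "measure gauss F \<le> V" and \<kappa>: "0 < \<kappa>"
  shows "h \<in> atomic_hull gauss {a. gauss_atom \<infinity> a} (\<kappa> * V)"
proof -
  note F' = admissible_ballD[OF F]
  have V0: "0 < V" using F' V by simp
  let ?z = "\<kappa> * V"
  have z: "0 < ?z" using \<kappa> V0 by simp
  have "gauss_atom \<infinity> (\<lambda>x. h x / ?z)"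
    unfolding gauss_atom_infinity_iff
  proof (intro disjI2 conjI exI)
    show "(\<lambda>x. h x / ?z) \<in> borel_measurable borel" using h by measurable
    show "admissible_ball F" by (rule F)
    show "AE x in gauss. x \<notin> F \<longrightarrow> h x / ?z = 0" using supp by eventually_elim auto
    show "(\<integral>x. h x / ?z \<partial>gauss) = 0" using mean by (subst integral_divide_zero) simp
    show "AE x in gauss. norm (h x / ?z) \<le> 1 / measure gauss F"
      using le
    proof eventually_elim
      case (elim x)
      have "norm (h x / ?z) = norm (h x) / ?z" using z by (simp add: norm_divide del: of_real_mult)
      also have "\<dots> \<le> \<kappa> / ?z" using elim z by (intro divide_right_mono) auto
      also have "\<dots> = 1 / V" using \<kappa> by simp
      also have "\<dots> \<le> 1 / measure gauss F" using F'(1) V by (intro divide_left_mono) auto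
      finally show ?case .
    qed
  qed
  then have "(\<lambda>x. complex_of_real ?z * (h x / ?z)) \<in> atomic_hull gauss {a. gauss_atom \<infinity> a} (norm (complex_of_real ?z))"
    by (intro atomic_hull_single) (use h in simp_all)
  moreover have "(\<lambda>x. complex_of_real ?z * (h x / ?z)) = h"
    using V0 \<kappa> by (intro ext) simp
  moreover have "norm (complex_of_real ?z) = ?z"
    using z by (simp del: of_real_mult)
  ultimately show ?thesis by simp
qed

lemma atomic_decomposition_iff:
  fixes f :: "'a::euclidean_space \<Rightarrow> complex"
  assumes A: "L1_bounded gauss L {a :: 'a \<Rightarrow> complex. gauss_atom r a}" and f: "integrable gauss f"
  shows "atomic_decomposition r f l a \<longleftrightarrow> (\<forall>j. gauss_atom r (a j)) \<and>
     summable (\<lambda>j. norm (l j)) \<and> (AE x in gauss. (\<lambda>j. l j * a j x) sums f x)"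
  using L1_limit_iff_AE_sums[OF A, of a l f] f unfolding atomic_decomposition_def by auto

lemma gauss_hardy_norm_le:
  fixes f :: "'a::euclidean_space \<Rightarrow> complex"
  assumes A: "L1_bounded gauss L {a :: 'a \<Rightarrow> complex. gauss_atom r a}" and f: "integrable gauss f"
    and S: "f \<in> atomic_hull gauss {a. gauss_atom r a} S"
  shows "f \<in> gauss_hardy r" "gauss_hardy_norm r f \<le> S"
proof -
  obtain l a where *: "atomic_decomposition r f l a" "(\<Sum>j. norm (l j)) \<le> S"
    using S unfolding atomic_hull_def atomic_decomposition_iff[OF A f] by auto
  then show "f \<in> gauss_hardy r" using f by (auto simp: gauss_hardy_def)
  have "bdd_below {(\<Sum>j. norm (l j)) | l. \<exists>a. atomic_decomposition r f l a}"
    by (rule bdd_belowI[of _ 0]) (auto simp: atomic_decomposition_def intro: suminf_nonneg)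
  with * show "gauss_hardy_norm r f \<le> S"
    unfolding gauss_hardy_norm_def by (intro cInf_lower2) auto
qed

lemma le_gauss_hardy_norm:
  fixes f :: "'a::euclidean_space \<Rightarrow> complex"
  assumes A: "L1_bounded gauss L {a :: 'a \<Rightarrow> complex. gauss_atom r a}" and f: "f \<in> gauss_hardy r"
    and c: "\<And>S. f \<in> atomic_hull gauss {a. gauss_atom r a} S \<Longrightarrow> c \<le> S"
  shows "c \<le> gauss_hardy_norm r f"
proof -
  have int: "integrable gauss f" using f by (simp add: gauss_hardy_def)
  show ?thesis
    unfolding gauss_hardy_norm_def
  proof (rule cInf_greatest)
    show "{(\<Sum>j. norm (l j)) | l. \<exists>a. atomic_decomposition r f l a} \<noteq> {}"
      using f by (auto simp: gauss_hardy_def)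
    fix s assume "s \<in> {(\<Sum>j. norm (l j)) | l. \<exists>a. atomic_decomposition r f l a}"
    then have "f \<in> atomic_hull gauss {a. gauss_atom r a} s"
      using int unfolding atomic_hull_def by (auto simp: atomic_decomposition_iff[OF A int])
    then show "c \<le> s" by (rule c)
  qed
qed

lemma gauss_hardy_imp_atomic_hull:
  fixes f :: "'a::euclidean_space \<Rightarrow> complex"
  assumes A: "L1_bounded gauss L {a :: 'a \<Rightarrow> complex. gauss_atom r a}" and f: "f \<in> gauss_hardy r"
  obtains S where "f \<in> atomic_hull gauss {a. gauss_atom r a} S"
proof -
  have int: "integrable gauss f" using f by (simp add: gauss_hardy_def)
  obtain l a where "atomic_decomposition r f l a" using f by (auto simp: gauss_hardy_def)
  then have "f \<in> atomic_hull gauss {a. gauss_atom r a} (\<Sum>j. norm (l j))"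
    using int unfolding atomic_hull_def by (auto simp: atomic_decomposition_iff[OF A int])
  then show ?thesis by (rule that)
qed

section \<open>Stopping cells in nested partitions\<close>

text \<open>The combinatorial content of a dyadic grid: at each level a countable measurable partition, each
refining the previous one, with cells shrinking to points.\<close>

locale nested_cells =
  fixes cell :: "nat \<Rightarrow> 'a::{second_countable_topology, complete_space} \<Rightarrow> 'a set"
  assumes mem_cell: "x \<in> cell k x"
    and cell_eq: "y \<in> cell k x \<Longrightarrow> cell k y = cell k x"
    and cell_Suc: "cell (Suc k) x \<subseteq> cell k x"
    and cell_borel: "cell k x \<in> sets borel"
    and countable_cells: "countable (range (cell k))"
    and cell_small: "open U \<Longrightarrow> x \<in> U \<Longrightarrow> \<exists>k. cell k x \<subseteq> U"
begin

lemma cell_antimono: "i \<le> k \<Longrightarrow> cell k x \<subseteq> cell i x"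
  by (rule lift_Suc_antimono_le[of "\<lambda>k. cell k x"]) (use cell_Suc in auto)

text \<open>Two cells are either nested or disjoint. Hence the cells that satisfy \<open>P\<close> while none of their
ancestors does are pairwise disjoint, and they cover all cells that satisfy \<open>P\<close>. In the enumeration
the empty set fills the indices which do not correspond to a cell.\<close>

lemma maximal_cells:
  "\<exists>Q :: nat \<Rightarrow> 'a set. disjoint_family Q \<and> (\<forall>j. Q j \<in> sets borel) \<and>
    (\<forall>j. Q j = {} \<or> (\<exists>k x. Q j = cell k x \<and> P (cell k x) \<and> (\<forall>i<k. \<not> P (cell i x)))) \<and>
    (\<Union>j. Q j) = {x. \<exists>k. P (cell k x)}"
proof -
  let ?k = "\<lambda>x. LEAST k. P (cell k x)"
  define F where "F = (\<lambda>x. cell (?k x) x) ` {x. \<exists>k. P (cell k x)}"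
  have "F \<subseteq> (\<Union>k. range (cell k))" by (auto simp: F_def)
  then have cnt: "countable F"
    by (rule countable_subset) (use countable_cells in auto)
  have F: "\<exists>k x. A = cell k x \<and> P (cell k x) \<and> (\<forall>i<k. \<not> P (cell i x))" if "A \<in> F" for A
  proof -
    from that obtain x k where x: "P (cell k x)" "A = cell (?k x) x" by (auto simp: F_def)
    then have "P (cell (?k x) x)" by (metis LeastI)
    moreover have "\<forall>i<?k x. \<not> P (cell i x)" using not_less_Least by blast
    ultimately show ?thesis using x(2) by blast
  qed
  have disj: "A = B" if AB: "A \<in> F" "B \<in> F" "z \<in> A" "z \<in> B" for A B z
  proof -
    obtain k x where A: "A = cell k x" "P (cell k x)" "\<forall>i<k. \<not> P (cell i x)" using F[OF AB(1)] by blast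
    obtain l y where B: "B = cell l y" "P (cell l y)" "\<forall>i<l. \<not> P (cell i y)" using F[OF AB(2)] by blast
    have zA: "cell i z = cell i x" if "i \<le> k" for i
      using cell_antimono[OF that, of x] AB(3) A(1) by (intro cell_eq) auto
    have zB: "cell i z = cell i y" if "i \<le> l" for i
      using cell_antimono[OF that, of y] AB(4) B(1) by (intro cell_eq) auto
    have "k = l"
      using A(2,3) B(2,3) zA zB by (metis less_imp_le linorder_neqE_nat order_refl)
    then show ?thesis using A(1) B(1) zA[of k] zB[of l] by simp
  qed
  define Q where "Q j = (if \<exists>A\<in>F. to_nat_on F A = j then THE A. A \<in> F \<and> to_nat_on F A = j else {})" for j
  have QF: "Q (to_nat_on F A) = A" if "A \<in> F" for A
  proof -
    have "(THE A'. A' \<in> F \<and> to_nat_on F A' = to_nat_on F A) = A"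
      by (rule the_equality) (use that inj_on_to_nat_on[OF cnt] in \<open>auto dest: inj_onD\<close>)
    with that show ?thesis by (auto simp: Q_def)
  qed
  have Q: "Q j = {} \<or> Q j \<in> F \<and> to_nat_on F (Q j) = j" for j
  proof (cases "\<exists>A\<in>F. to_nat_on F A = j")
    case True
    then show ?thesis using QF by auto
  qed (simp add: Q_def)
  have 1: "disjoint_family Q"
    unfolding disjoint_family_on_def using Q disj by (metis disjoint_iff empty_iff)
  have 2: "Q j = {} \<or> (\<exists>k x. Q j = cell k x \<and> P (cell k x) \<and> (\<forall>i<k. \<not> P (cell i x)))" for j
    using Q[of j] F by blast
  have 3: "Q j \<in> sets borel" for j using 2[of j] cell_borel by auto
  have 4: "(\<Union>j. Q j) = {x. \<exists>k. P (cell k x)}"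
  proof (intro equalityI subsetI)
    fix x assume "x \<in> (\<Union>j. Q j)"
    then obtain j where "x \<in> Q j" by auto
    with 2[of j] obtain k y where "x \<in> cell k y" "P (cell k y)" by auto
    then have "P (cell k x)" using cell_eq by simp
    then show "x \<in> {x. \<exists>k. P (cell k x)}" by blast
  next
    fix x assume "x \<in> {x. \<exists>k. P (cell k x)}"
    then have "cell (?k x) x \<in> F" by (auto simp: F_def)
    then show "x \<in> (\<Union>j. Q j)" using QF mem_cell by blast
  qed
  show ?thesis using 1 2 3 4 by blast
qed

text \<open>This is the part of Lebesgue's differentiation theorem that the Calderon--Zygmund decomposition
needs. Let \<open>E\<close> be a set of positive measure on which \<open>\<phi>\<close> exceeds \<open>(1 + \<delta>) * \<tau>\<close> although all averages
over cells meeting \<open>E\<close> are at most \<open>\<tau>\<close>. Then \<open>E\<close> fills at most the fraction \<open>1 / (1 + \<delta>)\<close> of each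
such cell. Every open set containing \<open>E\<close> is a disjoint union of cells, so its measure is at least
\<open>1 + \<delta>\<close> times the measure of \<open>E\<close>, contrary to outer regularity.\<close>

lemma AE_le_off_bad_cells:
  fixes \<phi> :: "'a \<Rightarrow> real"
  assumes M: "sets M = sets borel" "finite_measure M"
    and \<phi>: "integrable M \<phi>" "\<And>x. 0 \<le> \<phi> x" and \<tau>: "0 < \<tau>"
  shows "AE x in M. (\<forall>k. (LINT y:cell k x|M. \<phi> y) \<le> \<tau> * measure M (cell k x)) \<longrightarrow> \<phi> x \<le> \<tau>"
proof -
  interpret finite_measure M by fact
  have [measurable_cong]: "sets M = sets borel" by fact
  have space: "space M = UNIV" using M(1) sets_eq_imp_space_eq by force
  have [measurable]: "\<phi> \<in> borel_measurable M" using \<phi>(1) by auto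
  define bad where "bad W \<longleftrightarrow> (LINT y:W|M. \<phi> y) > \<tau> * measure M W" for W
  define G where "G = {x. \<forall>k. \<not> bad (cell k x)}"
  have "(\<exists>Q :: nat \<Rightarrow> 'a set. (\<forall>j. Q j \<in> sets borel) \<and> (\<Union>j. Q j) = {x. \<exists>k. bad (cell k x)})"
    using maximal_cells[of bad] by blast
  then have "{x. \<exists>k. bad (cell k x)} \<in> sets borel" by (metis sets.countable_UN image_subset_iff)
  moreover have "G = UNIV - {x. \<exists>k. bad (cell k x)}" by (auto simp: G_def)
  ultimately have G: "G \<in> sets M" using M(1) by auto
  have null: "{x\<in>G. \<phi> x > \<tau> * (1 + 1 / Suc n)} \<in> null_sets M" for n
  proof (rule ccontr)
    let ?\<delta> = "1 / real (Suc n)"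
    define E where "E = {x\<in>G. \<phi> x > \<tau> * (1 + ?\<delta>)}"
    assume "{x\<in>G. \<phi> x > \<tau> * (1 + 1 / Suc n)} \<notin> null_sets M"
    then have "E \<notin> null_sets M" by (simp add: E_def)
    moreover have E: "E \<in> sets M"
    proof -
      have "E = G \<inter> {x\<in>space M. \<phi> x > \<tau> * (1 + ?\<delta>)}" by (auto simp: E_def space)
      then show ?thesis using G by simp
    qed
    ultimately have pos: "0 < measure M E"
      by (metis null_setsI emeasure_eq_measure ennreal_0 measure_nonneg order_le_less)
    have EU: "emeasure M E = (INF U\<in>{U. E \<subseteq> U \<and> open U}. emeasure M U)"
      by (rule outer_regular) (use M E in \<open>auto simp: emeasure_eq_measure\<close>)
    have "emeasure M E < ennreal ((1 + ?\<delta>) * measure M E)"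
      using pos by (simp add: emeasure_eq_measure ennreal_lessI algebra_simps)
    then have "\<exists>U\<in>{U. E \<subseteq> U \<and> open U}. emeasure M U < ennreal ((1 + ?\<delta>) * measure M E)"
      unfolding EU by (simp add: INF_less_iff)
    then obtain U where U: "E \<subseteq> U" "open U" "measure M U < (1 + ?\<delta>) * measure M E"
      using pos by (auto simp: emeasure_eq_measure ennreal_less_iff)
    obtain Q :: "nat \<Rightarrow> 'a set" where Q: "disjoint_family Q" "\<And>j. Q j \<in> sets borel"
      "\<And>j. Q j = {} \<or> (\<exists>k x. Q j = cell k x \<and> cell k x \<subseteq> U \<and> (\<forall>i<k. \<not> cell i x \<subseteq> U))"
      "(\<Union>j. Q j) = {x. \<exists>k. cell k x \<subseteq> U}"
      using maximal_cells[of "\<lambda>W. W \<subseteq> U"] by blast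
    have QU: "(\<Union>j. Q j) = U"
      unfolding Q(4) using mem_cell cell_small[OF U(2)] by blast
    have Qm: "range Q \<subseteq> sets M" using Q(2) M(1) by auto
    have key: "(1 + ?\<delta>) * measure M (Q j \<inter> E) \<le> measure M (Q j)" for j
    proof (cases "Q j \<inter> E = {}")
      case False
      then obtain x where x: "x \<in> Q j" "x \<in> E" by auto
      from Q(3)[of j] x obtain k y where "Q j = cell k y" by auto
      with x(1) have Qx: "Q j = cell k x" using cell_eq by auto
      have le: "(LINT y:Q j|M. \<phi> y) \<le> \<tau> * measure M (Q j)"
        using x(2) unfolding E_def G_def bad_def Qx by (auto simp: not_less)
      have "\<tau> * (1 + ?\<delta>) * measure M (Q j \<inter> E) = (LINT y:(Q j \<inter> E)|M. \<tau> * (1 + ?\<delta>))"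
        using Qm E by (simp add: set_lebesgue_integral_def sets.Int Int_absorb2 sets.sets_into_space mult.commute)
      also have "\<dots> \<le> (LINT y:Q j|M. \<phi> y)"
        unfolding set_lebesgue_integral_def
      proof (rule integral_mono)
        show "integrable M (\<lambda>y. indicat_real (Q j \<inter> E) y *\<^sub>R (\<tau> * (1 + ?\<delta>)))"
          using Qm E by (intro integrable_real_indicator integrable_scaleR_left) (auto simp: emeasure_eq_measure)
        show "integrable M (\<lambda>y. indicat_real (Q j) y *\<^sub>R \<phi> y)"
          using Qm \<phi>(1) by (intro integrable_mult_indicator) auto
        show "indicat_real (Q j \<inter> E) y *\<^sub>R (\<tau> * (1 + ?\<delta>)) \<le> indicat_real (Q j) y *\<^sub>R \<phi> y" for y
          using \<phi>(2)[of y] by (auto simp: indicator_def E_def)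
      qed
      also note le
      finally have "\<tau> * ((1 + ?\<delta>) * measure M (Q j \<inter> E)) \<le> \<tau> * measure M (Q j)" by (simp add: mult.assoc)
      then show ?thesis using \<tau> by (simp only: mult_le_cancel_left_pos)
    qed simp
    have "(\<lambda>j. measure M (Q j)) sums measure M U"
      using finite_measure_UNION[OF Qm Q(1)] QU by simp
    moreover have "(\<lambda>j. measure M (Q j \<inter> E)) sums measure M E"
    proof -
      have "(\<lambda>j. measure M (Q j \<inter> E)) sums measure M (\<Union>j. Q j \<inter> E)"
        using Qm E Q(1) by (intro finite_measure_UNION) (auto simp: disjoint_family_on_def)
      moreover have "(\<Union>j. Q j \<inter> E) = E" using QU U(1) by auto
      ultimately show ?thesis by simp
    qed
    ultimately have "(1 + ?\<delta>) * measure M E \<le> measure M U"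
      using sums_mult[of _ "measure M E" "1 + ?\<delta>"] key by (meson sums_le)
    with U(3) show False by simp
  qed
  have "AE x in M. \<forall>n. x \<notin> {x\<in>G. \<phi> x > \<tau> * (1 + 1 / Suc n)}"
    unfolding AE_all_countable by (intro allI AE_not_in null)
  then show ?thesis
  proof eventually_elim
    case (elim x)
    show ?case
    proof
      assume "\<forall>k. (LINT y:cell k x|M. \<phi> y) \<le> \<tau> * measure M (cell k x)"
      then have "x \<in> G" by (auto simp: G_def bad_def not_less)
      with elim have *: "\<phi> x \<le> \<tau> * (1 + 1 / Suc n)" for n by (auto simp: not_less)
      have "(\<lambda>n. \<tau> * (1 + 1 / Suc n)) \<longlonglongrightarrow> \<tau> * (1 + 0)"
        by (intro tendsto_intros LIMSEQ_Suc[OF lim_inverse_n'])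
      then show "\<phi> x \<le> \<tau>" using * by (intro LIMSEQ_le_const) auto
    qed
  qed
qed

end

section \<open>Bounded functions near an admissible ball\<close>

lemma integral_sums_if_summable_L1:
  fixes f :: "nat \<Rightarrow> 'a \<Rightarrow> complex"
  assumes f: "\<And>j. f j \<in> borel_measurable M"
    and bound: "\<And>j. (\<integral>\<^sup>+x. ennreal (norm (f j x)) \<partial>M) \<le> ennreal (c j)"
    and c: "\<And>j. 0 \<le> c j" "summable c"
    and F: "F \<in> borel_measurable M" "AE x in M. (\<lambda>j. f j x) sums F x"
  shows "(\<lambda>j. \<integral>x. f j x \<partial>M) sums (\<integral>x. F x \<partial>M)"
proof -
  have i: "integrable M (f j)" for j
    by (rule integrableI_bounded[OF f le_less_trans[OF bound]]) simp
  have le: "(\<integral>x. norm (f j x) \<partial>M) \<le> c j" for j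
  proof -
    have "ennreal (\<integral>x. norm (f j x) \<partial>M) = (\<integral>\<^sup>+x. ennreal (norm (f j x)) \<partial>M)"
      by (rule nn_integral_eq_integral[symmetric]) (use i in auto)
    also note bound[of j]
    finally show ?thesis using c(1) by simp
  qed
  have s: "summable (\<lambda>j. \<integral>x. norm (f j x) \<partial>M)"
    by (rule summable_comparison_test'[OF c(2)]) (use le in auto)
  have "(\<lambda>j. \<integral>x. f j x \<partial>M) sums (\<integral>x. (\<Sum>j. f j x) \<partial>M)"
    by (rule sums_integral[OF i AE_summable_norm_if_summable_L1[OF f bound c] s])
  also have "(\<integral>x. (\<Sum>j. f j x) \<partial>M) = (\<integral>x. F x \<partial>M)"
    by (rule integral_cong_AE) (use f F in \<open>auto elim!: eventually_mono simp: sums_iff\<close>)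
  finally show ?thesis .
qed

lemma sums_indicator_disjoint:
  fixes f :: "nat \<Rightarrow> 'b::{real_normed_vector, semiring_1}"
  assumes "disjoint_family Q"
  shows "x \<in> Q j \<Longrightarrow> (\<lambda>i. indicator (Q i) x * f i) sums f j"
    and "x \<notin> (\<Union>j. Q j) \<Longrightarrow> (\<lambda>i. indicator (Q i) x * f i) sums 0"
proof -
  assume x: "x \<in> Q j"
  have "(\<lambda>i. indicator (Q i) x * f i) = (\<lambda>i. if i = j then f i else 0)"
  proof
    fix i
    show "indicator (Q i) x * f i = (if i = j then f i else 0)"
      using assms x unfolding disjoint_family_on_def by (cases "i = j") (auto simp: indicator_def)
  qed
  then show "(\<lambda>i. indicator (Q i) x * f i) sums f j" using sums_single[of j f] by simp
qed (simp add: sums_0)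

lemma powr_norm_diff_le:
  fixes u v :: "'b::real_normed_vector"
  assumes "0 < p"
  shows "norm (u - v) powr p \<le> 2 powr p * (norm u powr p + norm v powr p)"
proof -
  let ?w = "max (norm u) (norm v)"
  have "norm (u - v) \<le> 2 * ?w" using norm_triangle_ineq4[of u v] by simp
  then have "norm (u - v) powr p \<le> (2 * ?w) powr p"
    using assms by (intro powr_mono2) auto
  also have "\<dots> = 2 powr p * ?w powr p" by (simp add: powr_mult)
  also have "\<dots> \<le> 2 powr p * (norm u powr p + norm v powr p)"
    by (intro mult_left_mono) (auto simp: max_def)
  finally show ?thesis .
qed

text \<open>A grid adapted to an admissible ball \<open>B\<close>. All comparisons of measures that the decomposition needs
are collected with one constant \<open>\<Theta>\<close>, so that the resulting bounds visibly do not depend on the ball.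
The set \<open>N\<close> is a neighbourhood of \<open>B\<close>: the coarsest cells meeting \<open>B\<close> stick out of \<open>B\<close>, but only
within \<open>N\<close>, which bounds their total measure. As their union need not lie in an admissible ball,
mass has to be moved back into \<open>B\<close>. For this purpose the last condition provides, for each coarsest
cell, a set \<open>E\<close> inside \<open>B\<close> that lies together with the cell in one admissible ball \<open>F\<close>.\<close>

locale admissible_cells = nested_cells cell
  for cell :: "nat \<Rightarrow> 'a::euclidean_space \<Rightarrow> 'a set" +
  fixes B N :: "'a set" and \<Theta> :: real
  assumes B: "admissible_ball B" and N: "N \<in> sets borel"
    and \<Theta>: "1 \<le> \<Theta>"
    and cell_0_subset: "x \<in> B \<Longrightarrow> cell 0 x \<subseteq> N"
    and measure_N: "measure gauss N \<le> \<Theta> * measure gauss B"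
    and measure_cell_0: "x \<in> B \<Longrightarrow> measure gauss B \<le> \<Theta> * measure gauss (cell 0 x)"
    and doubling: "x \<in> B \<Longrightarrow> measure gauss (cell k x) \<le> \<Theta> * measure gauss (cell (Suc k) x)"
    and cell_in_ball: "x \<in> B \<Longrightarrow> \<exists>F. admissible_ball F \<and> cell k x \<subseteq> F \<and>
      measure gauss F \<le> \<Theta> * measure gauss (cell k x)"
    and cell_0_link: "x \<in> B \<Longrightarrow> \<exists>E F. E \<in> sets borel \<and> admissible_ball F \<and> E \<subseteq> B \<and> E \<subseteq> F \<and> cell 0 x \<subseteq> F \<and>
      measure gauss B \<le> \<Theta> * measure gauss E \<and> measure gauss (cell 0 x) \<le> \<Theta> * measure gauss E \<and>
      measure gauss F \<le> \<Theta> * measure gauss (cell 0 x)"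
begin

sublocale prob_space "gauss :: 'a measure" by (rule prob_space_gauss)

lemma measure_B_pos: "0 < measure gauss B" and B_borel: "B \<in> sets borel"
  using admissible_ballD[OF B] by auto

lemma integrable_indicator_mult:
  fixes f :: "'a \<Rightarrow> complex"
  assumes f: "f \<in> borel_measurable borel" and S: "S \<in> sets borel"
    and C: "AE x in gauss. norm (f x) \<le> C"
  shows "integrable gauss (\<lambda>x. indicator S x * f x)"
    and "norm (\<integral>x. indicator S x * f x \<partial>gauss) \<le> C * measure gauss S"
    and "0 \<le> C \<Longrightarrow> (\<integral>\<^sup>+x. ennreal (norm (indicator S x * f x)) \<partial>gauss) \<le> ennreal (C * measure gauss S)"
proof -
  have int: "integrable gauss (\<lambda>x. C * indicator S x)"
    using S by (intro integrable_mult_right integrable_real_indicator) (auto simp: emeasure_eq_measure)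
  have le: "AE x in gauss. norm (indicator S x * f x) \<le> C * indicator S x"
    using C by eventually_elim (auto simp: indicator_def)
  have [measurable]: "f \<in> borel_measurable borel" "S \<in> sets borel" using f S by auto
  have m: "(\<lambda>x. indicator S x * f x) \<in> borel_measurable gauss"
    by simp
  show i: "integrable gauss (\<lambda>x. indicator S x * f x)"
    by (rule Bochner_Integration.integrable_bound[OF int m]) (use le in \<open>auto elim!: eventually_mono\<close>)
  have "norm (\<integral>x. indicator S x * f x \<partial>gauss) \<le> (\<integral>x. norm (indicator S x * f x) \<partial>gauss)"
    by (rule integral_norm_bound)
  also have "\<dots> \<le> (\<integral>x. C * indicator S x \<partial>gauss)"
    by (rule integral_mono_AE) (use i int le in auto)
  also have eq: "\<dots> = C * measure gauss S" using S by simp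
  finally show "norm (\<integral>x. indicator S x * f x \<partial>gauss) \<le> C * measure gauss S" .
  assume C0: "0 \<le> C"
  have "(\<integral>\<^sup>+x. ennreal (norm (indicator S x * f x)) \<partial>gauss) \<le> (\<integral>\<^sup>+x. ennreal (C * indicator S x) \<partial>gauss)"
    using le by (intro nn_integral_mono_AE) (auto elim!: eventually_mono intro!: ennreal_leI)
  also have "\<dots> = ennreal (\<integral>x. C * indicator S x \<partial>gauss)"
    by (rule nn_integral_eq_integral[OF int]) (use C0 in auto)
  also note eq
  finally show "(\<integral>\<^sup>+x. ennreal (norm (indicator S x * f x)) \<partial>gauss) \<le> ennreal (C * measure gauss S)" .
qed

text \<open>Split \<open>g\<close> into its restrictions to the coarsest cells \<open>P j\<close> meeting \<open>B\<close>, with integrals \<open>I j\<close>. The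
mass \<open>I j\<close> is transported in two steps, first from \<open>P j\<close> to a set \<open>E\<close> inside \<open>B\<close>, then from \<open>E\<close> to
the uniform distribution on \<open>B\<close>. Each step is a bounded function of mean zero in an admissible ball,
hence a multiple of an atom whose coefficient is proportional to the measure of \<open>P j\<close>. The masses
that arrive on \<open>B\<close> cancel, because they sum to the integral of \<open>g\<close>.\<close>

lemma bounded_mean_zero_in_hull:
  fixes g :: "'a \<Rightarrow> complex"
  assumes g: "g \<in> borel_measurable borel" and G: "0 < G" "AE x in gauss. norm (g x) \<le> G"
    and supp: "\<And>x. g x \<noteq> 0 \<Longrightarrow> \<exists>k. cell k x \<inter> B \<noteq> {}" and mean: "(\<integral>x. g x \<partial>gauss) = 0"
  shows "g \<in> atomic_hull gauss {a. gauss_atom \<infinity> a} (G * \<Theta>\<^sup>2 * (3 + \<Theta>) * measure gauss B)"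
proof -
  let ?A = "{a :: 'a \<Rightarrow> complex. gauss_atom \<infinity> a}"
  let ?m = "measure gauss B"
  note L1 = L1_bounded_gauss_atoms_infinity[where ?'a='a]
  have [measurable]: "g \<in> borel_measurable borel" by (rule g)
  obtain P :: "nat \<Rightarrow> 'a set" where P: "disjoint_family P" "\<And>j. P j \<in> sets borel"
    "\<And>j. P j = {} \<or> (\<exists>k x. P j = cell k x \<and> cell k x \<inter> B \<noteq> {} \<and> (\<forall>i<k. \<not> cell i x \<inter> B \<noteq> {}))"
    "(\<Union>j. P j) = {x. \<exists>k. cell k x \<inter> B \<noteq> {}}"
    using maximal_cells[of "\<lambda>W. W \<inter> B \<noteq> {}"] by blast
  have P0: "P j = {} \<or> (\<exists>x\<in>B. P j = cell 0 x)" for j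
  proof (cases "P j = {}")
    case False
    then obtain k x y where *: "P j = cell k x" "y \<in> cell k x" "y \<in> B" "\<forall>i<k. \<not> cell i x \<inter> B \<noteq> {}"
      using P(3)[of j] by blast
    have "k = 0"
    proof (rule ccontr)
      assume "k \<noteq> 0"
      then have "cell 0 x \<inter> B = {}" using *(4) by blast
      moreover have "y \<in> cell 0 x" using cell_antimono[of 0 k x] *(2) by auto
      ultimately show False using *(3) by auto
    qed
    then have "P j = cell 0 y" using *(1,2) cell_eq by metis
    then show ?thesis using *(3) by blast
  qed simp
  have Pm: "range P \<subseteq> sets gauss" using P(2) by auto
  have sumP: "(\<lambda>j. measure gauss (P j)) sums measure gauss (\<Union>j. P j)"
    by (rule finite_measure_UNION[OF Pm P(1)])
  have "(\<Union>j. P j) \<subseteq> N" using P0 cell_0_subset by fastforce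
  then have "measure gauss (\<Union>j. P j) \<le> measure gauss N"
    by (rule finite_measure_mono) (use N in auto)
  with measure_N have totP: "measure gauss (\<Union>j. P j) \<le> \<Theta> * ?m" by linarith
  define I where "I j = (\<integral>x. indicator (P j) x * g x \<partial>gauss)" for j
  have I: "norm (I j) \<le> G * measure gauss (P j)" for j
    unfolding I_def by (rule integrable_indicator_mult(2)[OF g P(2) G(2)])
  have gP: "(\<lambda>j. indicator (P j) x * g x) sums g x" for x
  proof (cases "x \<in> (\<Union>j. P j)")
    case True
    then show ?thesis using sums_indicator_disjoint(1)[OF P(1), of x _ "\<lambda>_. g x"] by auto
  next
    case False
    then have "g x = 0" using supp[of x] unfolding P(4) by auto
    then show ?thesis by (simp add: sums_0)
  qed
  have sumI: "I sums 0"
    unfolding I_def mean[symmetric]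
  proof (rule integral_sums_if_summable_L1[where c="\<lambda>j. G * measure gauss (P j)"])
    show "summable (\<lambda>j. G * measure gauss (P j))"
      using sums_summable[OF sumP] by (rule summable_mult)
    show "(\<integral>\<^sup>+x. ennreal (norm (indicator (P j) x * g x)) \<partial>gauss) \<le> ennreal (G * measure gauss (P j))" for j
      by (rule integrable_indicator_mult(3)[OF g P(2) G(2)]) (use G in auto)
    show "(\<lambda>x. indicator (P j) x * g x) \<in> borel_measurable gauss" for j
      using P(2)[of j] by simp
  qed (use gP G in auto)
  define w where "w j x = indicator (P j) x * g x - I j / ?m * indicator B x" for j x
  have w: "w j \<in> atomic_hull gauss ?A (G * \<Theta> * (3 + \<Theta>) * measure gauss (P j))" for j
  proof (cases "P j = {}")
    case True
    then have "w j = (\<lambda>x. 0)" by (simp add: w_def I_def fun_eq_iff)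
    then show ?thesis using atomic_hull_zero[OF L1, of 0] True by simp
  next
    case False
    then obtain y where y: "y \<in> B" "P j = cell 0 y" using P0 by blast
    obtain E F where EF: "E \<in> sets borel" "admissible_ball F" "E \<subseteq> B" "E \<subseteq> F" "P j \<subseteq> F"
      "?m \<le> \<Theta> * measure gauss E" "measure gauss F \<le> \<Theta> * measure gauss (P j)"
      and qe: "measure gauss (P j) \<le> \<Theta> * measure gauss E"
      using cell_0_link[OF y(1)] unfolding y(2) by blast
    have [measurable]: "E \<in> sets borel" "B \<in> sets borel" "P j \<in> sets borel"
      using EF(1) B_borel P(2) by auto
    let ?e = "measure gauss E" and ?q = "measure gauss (P j)"
    have e: "0 < ?e" using EF(6) measure_B_pos \<Theta> by (smt (verit) measure_nonneg mult_nonneg_nonneg mult_eq_0_iff)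
    have q: "0 < ?q" using measure_cell_0[OF y(1)] measure_B_pos \<Theta> unfolding y(2)
      by (smt (verit) measure_nonneg mult_nonneg_nonneg mult_eq_0_iff)
    have iE: "integrable gauss (\<lambda>x. complex_of_real (indicator S x))" if "S \<in> sets borel" for S :: "'a set"
      using that by (intro integrable_of_real integrable_real_indicator) (auto simp: emeasure_eq_measure)
    have ind: "complex_of_real (indicator S x) = indicator S x" for S and x :: 'a
      by (simp add: indicator_def)
    note iE' = iE[unfolded ind]
    have intE: "(\<integral>x. indicator S x \<partial>gauss) = complex_of_real (measure gauss S)" if "S \<in> sets borel" for S :: "'a set"
    proof -
      have "(\<integral>x. complex_of_real (indicator S x) \<partial>gauss) = complex_of_real (measure gauss S)"
        using that by (subst integral_complex_of_real) simp
      then show ?thesis unfolding ind .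
    qed
    \<comment> \<open>transport from the cell to \<open>E\<close>\<close>
    define h where "h x = indicator (P j) x * g x - I j / ?e * indicator E x" for x
    \<comment> \<open>transport from \<open>E\<close> to \<open>B\<close>\<close>
    define k where "k x = I j / ?e * indicator E x - I j / ?m * indicator B x" for x
    have Ie: "norm (I j / ?e) \<le> G * \<Theta>"
    proof -
      have "norm (I j / ?e) \<le> G * ?q / ?e"
        using I[of j] e by (simp add: norm_divide divide_right_mono)
      also have "\<dots> \<le> G * (\<Theta> * ?e) / ?e"
        using qe G e by (intro divide_right_mono mult_left_mono) auto
      finally show ?thesis using e by simp
    qed
    have "h \<in> atomic_hull gauss ?A (G * (1 + \<Theta>) * (\<Theta> * ?q))"
    proof (rule atomic_hull_infinity_atomI[OF _ EF(2)])
      show "h \<in> borel_measurable borel" unfolding h_def by measurable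
      show "AE x in gauss. x \<notin> F \<longrightarrow> h x = 0"
        using EF(4,5) by (intro AE_I2) (auto simp: h_def indicator_def)
      show "(\<integral>x. h x \<partial>gauss) = 0"
        unfolding h_def using integrable_indicator_mult(1)[OF g P(2) G(2), of j] iE'[OF EF(1)] intE[OF EF(1)] e
        by (subst Bochner_Integration.integral_diff) (auto simp: I_def)
      show "AE x in gauss. norm (h x) \<le> G * (1 + \<Theta>)"
        using G(2)
      proof eventually_elim
        case (elim x)
        have "norm (h x) \<le> norm (indicator (P j) x * g x) + norm (I j / ?e * indicator E x)"
          unfolding h_def by (rule norm_triangle_ineq4)
        also have "\<dots> \<le> G + G * \<Theta>"
          using elim Ie G(1) \<Theta> by (intro add_mono) (auto simp: indicator_def norm_mult)
        finally show ?case by (simp add: algebra_simps)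
      qed
      show "0 < G * (1 + \<Theta>)" using G \<Theta> by simp
    qed (rule EF(7))
    moreover have "k \<in> atomic_hull gauss ?A (2 * G * \<Theta> * ?q / ?m * ?m)"
    proof (rule atomic_hull_infinity_atomI[OF _ B])
      show "k \<in> borel_measurable borel" unfolding k_def by measurable
      show "AE x in gauss. x \<notin> B \<longrightarrow> k x = 0"
        using EF(3) by (intro AE_I2) (auto simp: k_def indicator_def)
      show "(\<integral>x. k x \<partial>gauss) = 0"
        unfolding k_def using iE'[OF EF(1)] intE[OF EF(1)] iE'[OF B_borel] intE[OF B_borel] e measure_B_pos
        by (subst Bochner_Integration.integral_diff) auto
      have Im: "norm (I j / ?m) \<le> G * \<Theta> * ?q / ?m"
      proof -
        have "norm (I j / ?m) \<le> G * ?q / ?m"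
          using I[of j] measure_B_pos by (simp add: norm_divide divide_right_mono)
        also have "\<dots> \<le> G * \<Theta> * ?q / ?m"
          using G \<Theta> by (intro divide_right_mono mult_right_mono) auto
        finally show ?thesis .
      qed
      have Ie2: "norm (I j / ?e) \<le> G * \<Theta> * ?q / ?m"
      proof -
        have "norm (I j / ?e) \<le> G * ?q / ?e"
          using I[of j] e by (simp add: norm_divide divide_right_mono)
        also have "\<dots> \<le> G * ?q / (?m / \<Theta>)"
          using EF(6) G \<Theta> measure_B_pos e by (intro divide_left_mono) (auto simp: field_simps)
        finally show ?thesis by (simp add: mult_ac)
      qed
      show "AE x in gauss. norm (k x) \<le> 2 * G * \<Theta> * ?q / ?m"
      proof (rule AE_I2)
        fix x
        have "norm (k x) \<le> norm (I j / ?e * indicator E x) + norm (I j / ?m * indicator B x)"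
          unfolding k_def by (rule norm_triangle_ineq4)
        also have "\<dots> \<le> G * \<Theta> * ?q / ?m + G * \<Theta> * ?q / ?m"
        proof (rule add_mono)
          have nn: "0 \<le> G * \<Theta> * ?q / ?m" using G \<Theta> by simp
          show "norm (I j / ?e * indicator E x) \<le> G * \<Theta> * ?q / ?m"
            using Ie2 nn by (auto simp: indicator_def norm_mult)
          show "norm (I j / ?m * indicator B x) \<le> G * \<Theta> * ?q / ?m"
            using Im nn by (auto simp: indicator_def norm_mult)
        qed
        finally show "norm (k x) \<le> 2 * G * \<Theta> * ?q / ?m" by simp
      qed
      show "0 < 2 * G * \<Theta> * ?q / ?m" using G \<Theta> q measure_B_pos by simp
    qed simp
    ultimately have "(\<lambda>x. h x + k x) \<in> atomic_hull gauss ?A (G * (1 + \<Theta>) * (\<Theta> * ?q) + 2 * G * \<Theta> * ?q / ?m * ?m)"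
      by (rule atomic_hull_add[OF L1])
    also have "(\<lambda>x. h x + k x) = w j"
      by (simp add: h_def k_def w_def fun_eq_iff)
    also have "G * (1 + \<Theta>) * (\<Theta> * ?q) + 2 * G * \<Theta> * ?q / ?m * ?m = G * \<Theta> * (3 + \<Theta>) * ?q"
      using measure_B_pos by (simp add: algebra_simps)
    finally show ?thesis .
  qed
  have "g \<in> atomic_hull gauss ?A (\<Sum>j. G * \<Theta> * (3 + \<Theta>) * measure gauss (P j))"
  proof (rule atomic_hull_sums[OF L1 w])
    show "summable (\<lambda>j. G * \<Theta> * (3 + \<Theta>) * measure gauss (P j))"
      using sums_summable[OF sumP] by (rule summable_mult)
    show "AE x in gauss. (\<lambda>j. w j x) sums g x"
    proof (rule AE_I2)
      fix x
      have "(\<lambda>j. I j / ?m * indicator B x) sums (0 / complex_of_real ?m * indicator B x)"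
        by (intro sums_mult2 sums_divide sumI)
      from sums_diff[OF gP[of x] this] show "(\<lambda>j. w j x) sums g x"
        by (simp add: w_def)
    qed
  qed simp
  then show ?thesis
  proof (rule atomic_hull_mono)
    have "(\<Sum>j. G * \<Theta> * (3 + \<Theta>) * measure gauss (P j)) = G * \<Theta> * (3 + \<Theta>) * measure gauss (\<Union>j. P j)"
      using sums_mult[OF sumP] by (simp add: sums_iff)
    also have "\<dots> \<le> G * \<Theta> * (3 + \<Theta>) * (\<Theta> * ?m)"
      using totP G \<Theta> by (intro mult_left_mono) auto
    finally show "(\<Sum>j. G * \<Theta> * (3 + \<Theta>) * measure gauss (P j)) \<le> G * \<Theta>\<^sup>2 * (3 + \<Theta>) * ?m"
      by (simp add: power2_eq_square mult_ac)
  qed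
qed

end

section \<open>Calderon--Zygmund decomposition of an atom\<close>

context admissible_cells
begin

text \<open>The stopping cells at height \<open>T\<close> are the maximal cells over which the average of \<open>norm a powr p\<close>
exceeds \<open>T powr p\<close>. The coarsest cells do not qualify: if such a cell meets \<open>B\<close>, its measure is
comparable to that of \<open>B\<close>, so the size condition of atoms bounds the average once \<open>t\<close> is at least
\<open>\<Theta>\<close>. Therefore each stopping cell has a parent that is not bad, and by doubling the average over
the stopping cell exceeds the threshold by at most the factor \<open>\<Theta>\<close>.\<close>

lemma bad_cells:
  fixes a :: "'a \<Rightarrow> complex"
  assumes p: "1 < p" and a: "a \<in> borel_measurable borel" "\<And>x. x \<notin> B \<Longrightarrow> a x = 0"
    and int: "integrable gauss (\<lambda>x. norm (a x) powr p)"
    and le: "(\<integral>x. norm (a x) powr p \<partial>gauss) \<le> measure gauss B powr (1 - p)"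
    and t: "\<Theta> \<le> t"
  defines "T \<equiv> t / measure gauss B"
  obtains Q :: "nat \<Rightarrow> 'a set" where "disjoint_family Q" "\<And>j. Q j \<in> sets borel"
    "\<And>j. Q j = {} \<or> (\<exists>k x. Q j = cell k x \<and> x \<in> B)"
    "\<And>j. T powr p * measure gauss (Q j) \<le> (LINT x:Q j|gauss. norm (a x) powr p)"
    "\<And>j. (LINT x:Q j|gauss. norm (a x) powr p) \<le> \<Theta> * T powr p * measure gauss (Q j)"
    "AE x in gauss. x \<notin> (\<Union>j. Q j) \<longrightarrow> norm (a x) \<le> T"
proof -
  let ?m = "measure gauss B" and ?\<phi> = "\<lambda>x. norm (a x) powr p"
  have T: "0 < T" using t \<Theta> measure_B_pos by (simp add: T_def)
  have [measurable]: "a \<in> borel_measurable borel" by (rule a)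
  have cint: "integrable gauss (\<lambda>x. indicator W x *\<^sub>R ?\<phi> x)" if "W \<in> sets borel" for W
    using that int by (intro integrable_mult_indicator) auto
  have mono: "(LINT x:W|gauss. ?\<phi> x) \<le> (LINT x:W'|gauss. ?\<phi> x)"
    if "W \<in> sets borel" "W' \<in> sets borel" "W \<subseteq> W'" for W W'
    unfolding set_lebesgue_integral_def
    by (rule integral_mono) (use that cint in \<open>auto simp: indicator_def\<close>)
  have zero: "(LINT x:W|gauss. ?\<phi> x) = 0" if "W \<inter> B = {}" for W
  proof -
    have "(\<lambda>x. indicator W x *\<^sub>R ?\<phi> x) = (\<lambda>x. 0)"
    proof
      fix x show "indicator W x *\<^sub>R ?\<phi> x = 0"
        using that a(2)[of x] by (cases "x \<in> W") auto
    qed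
    then show ?thesis unfolding set_lebesgue_integral_def by (simp only: integral_zero)
  qed
  define bad where "bad W \<longleftrightarrow> T powr p * measure gauss W < (LINT x:W|gauss. ?\<phi> x)" for W
  have bad_meets: "W \<inter> B \<noteq> {}" if "bad W" for W
    using that zero[of W] T unfolding bad_def by (smt (verit) measure_nonneg mult_nonneg_nonneg powr_ge_zero)
  have bad_0: "\<not> bad (cell 0 x)" for x
  proof
    assume bad: "bad (cell 0 x)"
    then obtain z where z: "z \<in> cell 0 x" "z \<in> B" using bad_meets by blast
    have eq: "cell 0 x = cell 0 z" using cell_eq[OF z(1)] by simp
    have "(LINT x:cell 0 x|gauss. ?\<phi> x) \<le> (LINT x:UNIV|gauss. ?\<phi> x)"
      by (rule mono) (auto simp: cell_borel)
    also have "\<dots> \<le> ?m powr (1 - p)" using le by (simp add: set_lebesgue_integral_def)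
    also have "\<dots> = ?m powr (- p) * ?m"
      using measure_B_pos by (simp add: powr_diff powr_minus field_simps)
    also have "\<dots> \<le> ?m powr (- p) * (\<Theta> * measure gauss (cell 0 x))"
      using measure_cell_0[OF z(2)] eq by (intro mult_left_mono) auto
    also have "\<dots> \<le> ?m powr (- p) * (t powr p * measure gauss (cell 0 x))"
    proof -
      have "\<Theta> \<le> t powr 1" using t \<Theta> by simp
      also have "\<dots> \<le> t powr p" using t \<Theta> p by (intro powr_mono) auto
      finally show ?thesis by (intro mult_left_mono mult_right_mono) auto
    qed
    also have "\<dots> = T powr p * measure gauss (cell 0 x)"
      using t \<Theta> by (simp add: T_def powr_divide powr_minus field_simps)
    finally show False using bad by (simp add: bad_def)
  qed
  obtain Q :: "nat \<Rightarrow> 'a set" where Q: "disjoint_family Q" "\<And>j. Q j \<in> sets borel"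
    "\<And>j. Q j = {} \<or> (\<exists>k x. Q j = cell k x \<and> bad (cell k x) \<and> (\<forall>i<k. \<not> bad (cell i x)))"
    "(\<Union>j. Q j) = {x. \<exists>k. bad (cell k x)}"
    using maximal_cells[of bad] by blast
  have Q': "Q j = {} \<or> (\<exists>k x. Q j = cell (Suc k) x \<and> x \<in> B \<and> bad (cell (Suc k) x) \<and> \<not> bad (cell k x))" for j
  proof (cases "Q j = {}")
    case False
    then obtain k x where *: "Q j = cell k x" "bad (cell k x)" "\<forall>i<k. \<not> bad (cell i x)"
      using Q(3)[of j] by blast
    obtain i where k: "k = Suc i" using *(2) bad_0 by (cases k) auto
    obtain z where z: "z \<in> cell k x" "z \<in> B" using bad_meets[OF *(2)] by blast
    have "cell k x = cell k z" using cell_eq[OF z(1)] by simp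
    moreover have "cell i x = cell i z" using cell_eq[of z i x] z(1) cell_Suc[of i x] k by auto
    ultimately show ?thesis using * k z(2) by (metis lessI)
  qed simp
  show ?thesis
  proof (rule that[OF Q(1,2)])
    fix j
    show "Q j = {} \<or> (\<exists>k x. Q j = cell k x \<and> x \<in> B)" using Q'[of j] by blast
    show "T powr p * measure gauss (Q j) \<le> (LINT x:Q j|gauss. ?\<phi> x)"
      using Q'[of j] by (auto simp: bad_def set_lebesgue_integral_def)
    show "(LINT x:Q j|gauss. ?\<phi> x) \<le> \<Theta> * T powr p * measure gauss (Q j)"
    proof (cases "Q j = {}")
      case False
      then obtain k x where *: "Q j = cell (Suc k) x" "x \<in> B" "\<not> bad (cell k x)" using Q'[of j] by blast
      have "(LINT x:Q j|gauss. ?\<phi> x) \<le> (LINT x:cell k x|gauss. ?\<phi> x)"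
        unfolding *(1) by (rule mono) (use cell_borel cell_Suc in auto)
      also have "\<dots> \<le> T powr p * measure gauss (cell k x)"
        using *(3) by (simp add: bad_def)
      also have "\<dots> \<le> T powr p * (\<Theta> * measure gauss (Q j))"
        unfolding *(1) by (intro mult_left_mono doubling *(2)) auto
      finally show ?thesis by (simp add: mult_ac)
    qed (simp add: set_lebesgue_integral_def)
  next
    have "AE x in gauss. (\<forall>k. (LINT y:cell k x|gauss. ?\<phi> y) \<le> T powr p * measure gauss (cell k x)) \<longrightarrow>
        ?\<phi> x \<le> T powr p"
      by (rule AE_le_off_bad_cells) (use int T finite_measure_axioms in auto)
    then show "AE x in gauss. x \<notin> (\<Union>j. Q j) \<longrightarrow> norm (a x) \<le> T"
    proof eventually_elim
      case (elim x)
      show ?case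
      proof
        assume "x \<notin> (\<Union>j. Q j)"
        then have "?\<phi> x \<le> T powr p" using elim unfolding Q(4) bad_def by (auto simp: not_less)
        then show "norm (a x) \<le> T"
          using T p by (smt (verit) powr_less_mono2)
      qed
    qed
  qed
qed

text \<open>The Calderon--Zygmund decomposition of an atom. Let \<open>c j\<close> be the mean of \<open>a\<close> over the stopping cell
\<open>Q j\<close>. The good part \<open>u\<close> equals \<open>c j\<close> on \<open>Q j\<close> and \<open>a\<close> elsewhere. It is bounded by a
multiple of \<open>T\<close> and has mean zero, so it costs a multiple of \<open>T\<close> times the measure of \<open>B\<close>, which is
a multiple of \<open>t\<close>. The oscillation of \<open>a\<close> on \<open>Q j\<close> is a multiple of an atom of exponent \<open>p\<close> with
coefficient proportional to \<open>T\<close> times the measure of \<open>Q j\<close>. By Chebyshev's inequality these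
coefficients add up to a multiple of \<open>t powr (1 - p)\<close>, which is small for large \<open>t\<close> as \<open>p > 1\<close>.\<close>

lemma atom_split:
  fixes a :: "'a \<Rightarrow> complex"
  assumes p: "1 < p" and a: "a \<in> borel_measurable borel" "\<And>x. x \<notin> B \<Longrightarrow> a x = 0"
    and mean: "(\<integral>x. a x \<partial>gauss) = 0"
    and int: "integrable gauss (\<lambda>x. norm (a x) powr p)"
    and le: "(\<integral>x. norm (a x) powr p \<partial>gauss) \<le> measure gauss B powr (1 - p)"
    and t: "\<Theta> \<le> t" "8 * \<Theta> * (1 + \<Theta>) \<le> t powr (p - 1)"
  shows "\<exists>u v. u \<in> atomic_hull gauss {a. gauss_atom \<infinity> a} ((1 + \<Theta>) * t * \<Theta>\<^sup>2 * (3 + \<Theta>)) \<and>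
    v \<in> atomic_hull gauss {a. gauss_atom (ereal p) a} (1 / 2) \<and> (\<forall>x. a x = u x + v x)"
proof -
  let ?m = "measure gauss B" and ?\<phi> = "\<lambda>x. norm (a x) powr p"
  let ?A = "{a :: 'a \<Rightarrow> complex. gauss_atom (ereal p) a}"
  define T where "T = t / ?m"
  have t0: "0 < t" using t(1) \<Theta> by simp
  have T: "0 < T" using t0 measure_B_pos by (simp add: T_def)
  note L1 = L1_bounded_gauss_atoms_real[OF p, where ?'a='a]
  have [measurable]: "a \<in> borel_measurable borel" by (rule a)
  obtain Q :: "nat \<Rightarrow> 'a set" where Q: "disjoint_family Q" "\<And>j. Q j \<in> sets borel"
    "\<And>j. Q j = {} \<or> (\<exists>k x. Q j = cell k x \<and> x \<in> B)"
    and Q_lower: "\<And>j. T powr p * measure gauss (Q j) \<le> (LINT x:Q j|gauss. ?\<phi> x)"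
    and Q_upper: "\<And>j. (LINT x:Q j|gauss. ?\<phi> x) \<le> \<Theta> * T powr p * measure gauss (Q j)"
    and off: "AE x in gauss. x \<notin> (\<Union>j. Q j) \<longrightarrow> norm (a x) \<le> T"
    using bad_cells[OF p a int le t(1)] unfolding T_def by blast
  have Qm [measurable]: "Q j \<in> sets borel" for j by (rule Q)
  have Qr: "range Q \<subseteq> sets gauss" using Q(2) by auto
  let ?G = "(1 + \<Theta>) * T"
  have G: "0 < ?G" using \<Theta> T by simp
  have sumQ: "(\<lambda>j. measure gauss (Q j)) sums measure gauss (\<Union>j. Q j)"
    by (rule finite_measure_UNION[OF Qr Q(1)])
  have phi_int: "integrable gauss (\<lambda>x. indicator W x *\<^sub>R ?\<phi> x)" if "W \<in> sets borel" for W
    using that int by (intro integrable_mult_indicator) auto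
  \<comment> \<open>Chebyshev's inequality for the stopping cells\<close>
  have totQ: "T powr p * measure gauss (\<Union>j. Q j) \<le> ?m powr (1 - p)"
  proof -
    have si: "set_integrable gauss (\<Union>j. Q j) ?\<phi>"
      unfolding set_integrable_def by (rule phi_int) auto
    have nonneg: "0 \<le> (LINT x:Q j|gauss. ?\<phi> x)" for j
      unfolding set_lebesgue_integral_def by (rule integral_nonneg_AE) auto
    have "summable (\<lambda>j. LINT x:Q j|gauss. ?\<phi> x)"
      by (rule summable_comparison_test'[OF summable_mult[OF sums_summable[OF sumQ], of "\<Theta> * T powr p"]])
        (use Q_upper nonneg in auto)
    then have "(\<Sum>j. T powr p * measure gauss (Q j)) \<le> (\<Sum>j. LINT x:Q j|gauss. ?\<phi> x)"
      by (intro suminf_le Q_lower summable_mult sums_summable[OF sumQ])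
    also have "\<dots> = (LINT x:(\<Union>j. Q j)|gauss. ?\<phi> x)"
      by (rule lebesgue_integral_countable_add[symmetric])
        (use Q(1) si in \<open>auto simp: disjoint_family_on_def\<close>)
    finally have "T powr p * measure gauss (\<Union>j. Q j) \<le> (LINT x:(\<Union>j. Q j)|gauss. ?\<phi> x)"
      using sums_mult[OF sumQ, of "T powr p"] by (simp add: sums_iff)
    also have "\<dots> \<le> (\<integral>x. ?\<phi> x \<partial>gauss)"
      unfolding set_lebesgue_integral_def
      by (rule integral_mono[OF phi_int int]) (auto simp: indicator_def)
    finally show ?thesis using le by simp
  qed
  have norm_int: "(\<integral>x. indicator (Q j) x * norm (a x) \<partial>gauss) \<le> ?G * measure gauss (Q j)"
    and a_int: "integrable gauss (\<lambda>x. indicator (Q j) x * a x)" for j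
  proof -
    let ?b = "\<lambda>x. T * indicator (Q j) x + T powr (1 - p) * (indicator (Q j) x *\<^sub>R ?\<phi> x)"
    have i1: "integrable gauss (\<lambda>x. T * indicator (Q j) x)"
      by (intro integrable_mult_right integrable_real_indicator) (auto simp: emeasure_eq_measure)
    have i2: "integrable gauss (\<lambda>x. T powr (1 - p) * (indicator (Q j) x *\<^sub>R ?\<phi> x))"
      by (intro integrable_mult_right phi_int) simp
    note i = Bochner_Integration.integrable_add[OF i1 i2]
    have pt: "indicator (Q j) x * norm (a x) \<le> ?b x" for x
      using powr_interpolation[OF norm_ge_zero T p, of "a x"] by (cases "x \<in> Q j") auto
    have nn: "norm (indicator (Q j) x * a x) = indicator (Q j) x * norm (a x)" for x
      by (simp add: indicator_def)
    show ai: "integrable gauss (\<lambda>x. indicator (Q j) x * a x)"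
      by (rule Bochner_Integration.integrable_bound[OF i])
        (use pt order_trans[OF pt abs_ge_self] in \<open>auto simp: nn\<close>)
    have ani: "integrable gauss (\<lambda>x. indicator (Q j) x * norm (a x))"
      using integrable_norm[OF ai] unfolding nn .
    have "(\<integral>x. indicator (Q j) x * norm (a x) \<partial>gauss) \<le> (\<integral>x. ?b x \<partial>gauss)"
      by (rule integral_mono[OF ani i pt])
    also have "\<dots> = T * measure gauss (Q j) + T powr (1 - p) * (LINT x:Q j|gauss. ?\<phi> x)"
      by (subst Bochner_Integration.integral_add[OF i1 i2]) (simp add: set_lebesgue_integral_def)
    also have "\<dots> \<le> T * measure gauss (Q j) + T powr (1 - p) * (\<Theta> * T powr p * measure gauss (Q j))"
      by (intro add_left_mono mult_left_mono Q_upper) auto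
    also have "\<dots> = ?G * measure gauss (Q j)"
    proof -
      have "T powr (1 - p) * T powr p = T" using T by (simp add: powr_add[symmetric])
      then show ?thesis by (simp add: algebra_simps)
    qed
    finally show "(\<integral>x. indicator (Q j) x * norm (a x) \<partial>gauss) \<le> ?G * measure gauss (Q j)" .
  qed
  define c where "c j = (\<integral>x. indicator (Q j) x * a x \<partial>gauss) / measure gauss (Q j)" for j
  have c: "norm (c j) \<le> ?G" for j
  proof (cases "measure gauss (Q j) = 0")
    case False
    then have pos: "0 < measure gauss (Q j)" by (simp add: zero_less_measure_iff)
    have "norm (\<integral>x. indicator (Q j) x * a x \<partial>gauss) \<le> (\<integral>x. norm (indicator (Q j) x * a x) \<partial>gauss)"
      by (rule integral_norm_bound)
    also have "\<dots> = (\<integral>x. indicator (Q j) x * norm (a x) \<partial>gauss)"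
      by (intro Bochner_Integration.integral_cong) (auto simp: indicator_def)
    also note norm_int[of j]
    finally show ?thesis using pos by (simp add: c_def norm_divide field_simps)
  qed (use G in \<open>simp add: c_def\<close>)
  \<comment> \<open>the oscillation on the stopping cell; a null cell has \<open>c j = 0\<close> by the convention for division\<close>
  define b where "b j x = indicator (Q j) x * (a x - c j)" for j x
  have b_mean: "(\<integral>x. b j x \<partial>gauss) = 0" for j
  proof -
    have ind: "complex_of_real (indicator (Q j) x) = indicator (Q j) x" for x by (simp add: indicator_def)
    have ii: "integrable gauss (\<lambda>x. complex_of_real (indicator (Q j) x) * c j)"
      by (intro integrable_mult_left integrable_of_real integrable_real_indicator) (auto simp: emeasure_eq_measure)
    have "(\<integral>x. b j x \<partial>gauss) = (\<integral>x. indicator (Q j) x * a x - complex_of_real (indicator (Q j) x) * c j \<partial>gauss)"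
      by (simp add: b_def ind right_diff_distrib)
    also have "\<dots> = (\<integral>x. indicator (Q j) x * a x \<partial>gauss) - measure gauss (Q j) * c j"
      by (subst Bochner_Integration.integral_diff[OF a_int ii]) simp
    also have "\<dots> = 0"
    proof (cases "measure gauss (Q j) = 0")
      case True
      then have "AE x in gauss. x \<notin> Q j"
        by (intro AE_not_in) (auto simp: null_sets_def emeasure_eq_measure)
      then have "AE x in gauss. indicator (Q j) x * a x = 0" by eventually_elim simp
      then have "(\<integral>x. indicator (Q j) x * a x \<partial>gauss) = 0"
        by (rule integral_eq_zero_AE)
      then show ?thesis using True by simp
    qed (simp add: c_def)
    finally show ?thesis .
  qed
  \<comment> \<open>two factors 2 from the inequality for powers of a difference and from adding two equal bounds\<close>
  let ?H = "4 * (1 + \<Theta>) * T"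
  have b_hull: "b j \<in> atomic_hull gauss ?A (?H * (\<Theta> * measure gauss (Q j)))" for j
  proof (cases "Q j = {}")
    case True
    then have "b j = (\<lambda>x. 0)" by (simp add: b_def fun_eq_iff)
    then show ?thesis using atomic_hull_zero[OF L1, of 0] True by simp
  next
    case False
    then obtain k x where Qj: "Q j = cell k x" "x \<in> B" using Q(3)[of j] by blast
    obtain F where F: "admissible_ball F" "Q j \<subseteq> F" "measure gauss F \<le> \<Theta> * measure gauss (Q j)"
      using cell_in_ball[OF Qj(2)] unfolding Qj(1) by blast
    let ?d = "\<lambda>x. 2 powr p * (indicator (Q j) x *\<^sub>R ?\<phi> x + ?G powr p * indicator (Q j) x)"
    have i1: "integrable gauss (\<lambda>x. ?G powr p * indicator (Q j) x)"
      by (intro integrable_mult_right integrable_real_indicator) (auto simp: emeasure_eq_measure)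
    have id: "integrable gauss ?d"
      by (intro integrable_mult_right Bochner_Integration.integrable_add phi_int i1) simp
    have pt: "norm (b j x) powr p \<le> ?d x" for x
    proof (cases "x \<in> Q j")
      case True
      have "norm (a x - c j) powr p \<le> 2 powr p * (?\<phi> x + norm (c j) powr p)"
        by (rule powr_norm_diff_le) (use p in simp)
      also have "\<dots> \<le> 2 powr p * (?\<phi> x + ?G powr p)"
        using c[of j] p by (intro mult_left_mono add_left_mono powr_mono2) auto
      finally show ?thesis using True by (simp add: b_def)
    qed (use p in \<open>simp add: b_def\<close>)
    have bm: "b j \<in> borel_measurable borel" unfolding b_def by measurable
    show ?thesis
    proof (rule atomic_hull_real_atomI[OF p bm F(1) _ b_mean _ _ F(3)])
      show "AE x in gauss. x \<notin> F \<longrightarrow> b j x = 0"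
        using F(2) by (intro AE_I2) (auto simp: b_def indicator_def)
      have [measurable]: "b j \<in> borel_measurable borel" by (rule bm)
      show ib: "integrable gauss (\<lambda>x. norm (b j x) powr p)"
        by (rule Bochner_Integration.integrable_bound[OF id])
          (use order_trans[OF pt abs_ge_self] in \<open>auto\<close>)
      have "(\<integral>x. norm (b j x) powr p \<partial>gauss) \<le> (\<integral>x. ?d x \<partial>gauss)"
        by (rule integral_mono[OF ib id pt])
      also have "\<dots> = 2 powr p * ((LINT x:Q j|gauss. ?\<phi> x) + ?G powr p * measure gauss (Q j))"
        using Bochner_Integration.integral_add[OF phi_int[OF Q(2)] i1, of j]
        by (simp add: set_lebesgue_integral_def)
      also have "\<dots> \<le> 2 powr p * (?G powr p * measure gauss (Q j) + ?G powr p * measure gauss (Q j))"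
      proof (intro mult_left_mono add_right_mono)
        have "\<Theta> \<le> (1 + \<Theta>) powr p"
        proof -
          have "\<Theta> \<le> (1 + \<Theta>) powr 1" using \<Theta> by simp
          also have "\<dots> \<le> (1 + \<Theta>) powr p" using \<Theta> p by (intro powr_mono) auto
          finally show ?thesis .
        qed
        then have "\<Theta> * T powr p \<le> ?G powr p"
          using \<Theta> T by (simp add: powr_mult mult_right_mono)
        then have "\<Theta> * T powr p * measure gauss (Q j) \<le> ?G powr p * measure gauss (Q j)"
          by (rule mult_right_mono) simp
        with Q_upper[of j] show "(LINT x:Q j|gauss. ?\<phi> x) \<le> ?G powr p * measure gauss (Q j)"
          by linarith
      qed simp
      also have "\<dots> = 2 powr p * 2 * (?G powr p * measure gauss (Q j))" by simp
      also have "\<dots> \<le> 2 powr p * 2 powr p * (?G powr p * (\<Theta> * measure gauss (Q j)))"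
      proof (intro mult_mono mult_left_mono)
        have "2 powr 1 \<le> (2::real) powr p" using p by (intro powr_mono) auto
        then show "2 \<le> (2::real) powr p" by simp
        show "measure gauss (Q j) \<le> \<Theta> * measure gauss (Q j)"
          using \<Theta> mult_right_mono[of 1 \<Theta> "measure gauss (Q j)"] by simp
      qed (use \<Theta> in auto)
      also have "\<dots> = ?H powr p * (\<Theta> * measure gauss (Q j))"
      proof -
        have "?H powr p = (2 * (2 * ?G)) powr p" by (simp add: mult_ac)
        also have "\<dots> = 2 powr p * (2 powr p * ?G powr p)" by (simp only: powr_mult)
        finally show ?thesis by (simp only: mult.assoc)
      qed
      finally show "(\<integral>x. norm (b j x) powr p \<partial>gauss) \<le> ?H powr p * (\<Theta> * measure gauss (Q j))" .
      show "0 < ?H" using \<Theta> T by simp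
    qed
  qed
  define v where "v x = (\<Sum>j. b j x)" for x
  have b_sums: "(\<lambda>j. b j x) sums (a x - c j)" if "x \<in> Q j" for x j
    unfolding b_def by (rule sums_indicator_disjoint(1)[OF Q(1) that])
  have v_in: "v x = a x - c j" if "x \<in> Q j" for x j
    unfolding v_def using b_sums[OF that] by (simp add: sums_iff)
  have b_sums_off: "(\<lambda>j. b j x) sums 0" if "x \<notin> (\<Union>j. Q j)" for x
    unfolding b_def by (rule sums_indicator_disjoint(2)[OF Q(1) that])
  have v_off: "v x = 0" if "x \<notin> (\<Union>j. Q j)" for x
    unfolding v_def using b_sums_off[OF that] by (simp add: sums_iff)
  have v_sums: "(\<lambda>j. b j x) sums v x" for x
    using b_sums b_sums_off v_in v_off by (cases "x \<in> (\<Union>j. Q j)") auto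
  have summ: "summable (\<lambda>j. ?H * (\<Theta> * measure gauss (Q j)))"
    by (intro summable_mult sums_summable[OF sumQ])
  have v_hull: "v \<in> atomic_hull gauss ?A (\<Sum>j. ?H * (\<Theta> * measure gauss (Q j)))"
    unfolding v_def by (rule atomic_hull_suminf(1)[OF L1 b_hull summ])
  have vm [measurable]: "v \<in> borel_measurable borel"
    using atomic_hull_measurable[OF v_hull] by simp
  have "(\<lambda>j. \<integral>x. b j x \<partial>gauss) sums (\<integral>x. v x \<partial>gauss)"
    by (rule integral_sums_if_summable_L1[where c="\<lambda>j. ?H * (\<Theta> * measure gauss (Q j)) * 2"])
      (use atomic_hull_L1_bound[OF L1 b_hull] atomic_hull_measurable[OF b_hull] summ v_sums \<Theta> T in
        \<open>auto intro: summable_mult2\<close>)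
  then have v_mean: "(\<integral>x. v x \<partial>gauss) = 0" by (simp add: b_mean sums_0 sums_iff)
  have v_int: "integrable gauss v"
    by (rule integrableI_bounded) (use le_less_trans[OF atomic_hull_L1_bound[OF L1 v_hull]] in auto)
  have a_int': "integrable gauss a"
  proof -
    have i: "integrable gauss (\<lambda>x. 1 + ?\<phi> x)"
      using int by simp
    have pt: "norm (a x) \<le> 1 + ?\<phi> x" for x
      using powr_interpolation[OF norm_ge_zero zero_less_one p, of "a x"] by simp
    show ?thesis
      by (rule Bochner_Integration.integrable_bound[OF i]) (use order_trans[OF pt abs_ge_self] in auto)
  qed
  have v_half: "v \<in> atomic_hull gauss ?A (1 / 2)"
    using v_hull
  proof (rule atomic_hull_mono)
    have "(\<Sum>j. ?H * (\<Theta> * measure gauss (Q j))) = ?H * \<Theta> * measure gauss (\<Union>j. Q j)"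
      using sums_mult[OF sumQ, of "?H * \<Theta>"] by (simp add: sums_iff mult.assoc)
    also have "\<dots> = 4 * (1 + \<Theta>) * \<Theta> * T powr (1 - p) * (T powr p * measure gauss (\<Union>j. Q j))"
    proof -
      have "T powr (1 - p) * T powr p = T" using T by (simp add: powr_add[symmetric])
      then show ?thesis by (simp add: mult_ac) 
    qed
    also have "\<dots> \<le> 4 * (1 + \<Theta>) * \<Theta> * T powr (1 - p) * ?m powr (1 - p)"
      using totQ \<Theta> by (intro mult_left_mono) auto
    also have "\<dots> = 4 * (1 + \<Theta>) * \<Theta> * t powr (1 - p)"
      using measure_B_pos t0 by (simp add: T_def powr_divide)
    also have "\<dots> = 4 * (1 + \<Theta>) * \<Theta> / t powr (p - 1)"
      using t0 by (simp add: powr_diff)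
    also have "\<dots> \<le> 1 / 2"
      using t(2) t0 by (simp add: field_simps)
    finally show "(\<Sum>j. ?H * (\<Theta> * measure gauss (Q j))) \<le> 1 / 2" .
  qed
  define u where "u x = a x - v x" for x
  have u_hull: "u \<in> atomic_hull gauss {a. gauss_atom \<infinity> a} (?G * \<Theta>\<^sup>2 * (3 + \<Theta>) * ?m)"
  proof (rule bounded_mean_zero_in_hull)
    show "u \<in> borel_measurable borel" unfolding u_def by measurable
    show "(\<integral>x. u x \<partial>gauss) = 0"
      unfolding u_def using a_int' v_int mean v_mean by (subst Bochner_Integration.integral_diff) auto
    show "AE x in gauss. norm (u x) \<le> ?G"
      using off
    proof eventually_elim
      case (elim x)
      show ?case
      proof (cases "x \<in> (\<Union>j. Q j)")
        case True
        then show ?thesis using v_in c by (auto simp: u_def)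
      next
        case False
        then have "norm (u x) \<le> T" using elim v_off by (simp add: u_def)
        also have "T \<le> ?G" using \<Theta> T by simp
        finally show ?thesis .
      qed
    qed
    show "\<exists>k. cell k x \<inter> B \<noteq> {}" if "u x \<noteq> 0" for x
    proof (cases "x \<in> (\<Union>j. Q j)")
      case True
      then obtain k y where "x \<in> cell k y" "y \<in> B" using Q(3) by blast
      then have "y \<in> cell k x" using cell_eq mem_cell by metis
      then show ?thesis using \<open>y \<in> B\<close> by blast
    next
      case False
      then have "x \<in> B" using that a(2)[of x] v_off by (auto simp: u_def)
      then show ?thesis using mem_cell by blast
    qed
  qed (rule G)
  also have "?G * \<Theta>\<^sup>2 * (3 + \<Theta>) * ?m = (1 + \<Theta>) * t * \<Theta>\<^sup>2 * (3 + \<Theta>)"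
    using measure_B_pos by (simp add: T_def)
  finally have "u \<in> atomic_hull gauss {a. gauss_atom \<infinity> a} ((1 + \<Theta>) * t * \<Theta>\<^sup>2 * (3 + \<Theta>))" .
  moreover have "\<forall>x. a x = u x + v x" by (simp add: u_def)
  ultimately show ?thesis using v_half by blast
qed

end

section \<open>Dyadic cubes at the admissible scale\<close>

definition grid_cube :: "real \<Rightarrow> 'a::euclidean_space \<Rightarrow> 'a set" where
  "grid_cube w x = {y. \<forall>i\<in>Basis. \<lfloor>(y \<bullet> i) / w\<rfloor> = \<lfloor>(x \<bullet> i) / w\<rfloor>}"

lemma grid_cube_iff:
  fixes w :: real
  assumes "0 < w"
  shows "y \<in> grid_cube w x \<longleftrightarrow>
    (\<forall>i\<in>Basis. w * \<lfloor>(x \<bullet> i) / w\<rfloor> \<le> y \<bullet> i \<and> y \<bullet> i < w * \<lfloor>(x \<bullet> i) / w\<rfloor> + w)"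
proof -
  have "\<lfloor>s / w\<rfloor> = a \<longleftrightarrow> w * real_of_int a \<le> s \<and> s < w * real_of_int a + w" for s a
    using assms by (simp add: floor_eq_iff field_simps)
  then show ?thesis by (simp add: grid_cube_def)
qed

lemma grid_cube_borel: "grid_cube w x \<in> sets borel"
proof -
  have "grid_cube w x = (\<Inter>i\<in>Basis. {y\<in>space borel. \<lfloor>(y \<bullet> i) / w\<rfloor> = \<lfloor>(x \<bullet> i) / w\<rfloor>})"
    by (auto simp: grid_cube_def)
  also have "\<dots> \<in> sets borel"
    by (intro sets.finite_INT) auto
  finally show ?thesis .
qed

lemma measure_grid_cube:
  fixes x :: "'a::euclidean_space" and w :: real
  assumes w: "0 < w"
  shows "measure lborel (grid_cube w x) = w ^ DIM('a)"
proof -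
  define l where "l = (\<Sum>i\<in>Basis. (w * \<lfloor>(x \<bullet> i) / w\<rfloor>) *\<^sub>R i)"
  define u where "u = l + w *\<^sub>R (\<Sum>i\<in>(Basis :: 'a set). i)"
  have l: "l \<bullet> i = w * \<lfloor>(x \<bullet> i) / w\<rfloor>" if "i \<in> Basis" for i
    using that by (simp add: l_def)
  have u: "u \<bullet> i = l \<bullet> i + w" if "i \<in> Basis" for i
    using that by (simp add: u_def inner_add_left inner_sum_left_Basis)
  have sub: "box l u \<subseteq> grid_cube w x" "grid_cube w x \<subseteq> cbox l u"
    using w by (auto simp: grid_cube_iff mem_box l u less_imp_le)
  have prod: "(\<Prod>b\<in>Basis. (u - l) \<bullet> b) = w ^ DIM('a)"
    by (simp add: inner_diff_left u)
  have fin: "emeasure lborel (cbox l u) < \<infinity>" "emeasure lborel (grid_cube w x) < \<infinity>"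
    using emeasure_bounded_finite[OF bounded_cbox] emeasure_bounded_finite[OF bounded_subset[OF bounded_cbox sub(2)]] by auto
  have "measure lborel (box l u) = w ^ DIM('a)" "measure lborel (cbox l u) = w ^ DIM('a)"
    using w u prod by (simp_all add: measure_lborel_box_eq measure_lborel_cbox_eq)
  moreover have "measure lborel (box l u) \<le> measure lborel (grid_cube w x)"
    using sub(1) fin grid_cube_borel[of w x] by (intro measure_mono_fmeasurable) (auto simp: fmeasurable_def)
  moreover have "measure lborel (grid_cube w x) \<le> measure lborel (cbox l u)"
    using sub(2) fin grid_cube_borel[of w x] by (intro measure_mono_fmeasurable) (auto simp: fmeasurable_def)
  ultimately show ?thesis by linarith
qed

lemma dist_grid_cube:
  fixes x y :: "'a::euclidean_space" and w :: real
  assumes w: "0 < w" and y: "y \<in> grid_cube w x"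
  shows "dist x y \<le> DIM('a) * w"
proof -
  have x: "x \<in> grid_cube w x" by (simp add: grid_cube_def)
  have "norm (x - y) \<le> (\<Sum>b\<in>Basis. \<bar>(x - y) \<bullet> b\<bar>)" by (rule norm_le_l1)
  also have "\<dots> \<le> (\<Sum>b\<in>(Basis :: 'a set). w)"
  proof (rule sum_mono)
    fix b :: 'a assume "b \<in> Basis"
    then show "\<bar>(x - y) \<bullet> b\<bar> \<le> w"
      using x y unfolding grid_cube_iff[OF w] inner_diff_left by (smt (verit))
  qed
  finally show ?thesis by (simp add: dist_norm)
qed

lemma grid_cube_half: "grid_cube (w / 2) x \<subseteq> grid_cube w x"
proof -
  have *: "\<lfloor>s / w\<rfloor> = \<lfloor>s / (w / 2)\<rfloor> div 2" for s
    using floor_divide_real_eq_div[of 2 "s / (w / 2)"] by simp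
  show ?thesis unfolding grid_cube_def * by auto
qed

lemma countable_grid_cubes: "countable (range (grid_cube w :: 'a::euclidean_space \<Rightarrow> 'a set))"
proof -
  have "range (grid_cube w :: 'a \<Rightarrow> 'a set) \<subseteq>
      (\<lambda>f. {y. \<forall>i\<in>Basis. \<lfloor>(y \<bullet> i) / w\<rfloor> = f i}) ` (Pi\<^sub>E (Basis :: 'a set) (\<lambda>_. UNIV))"
  proof
    fix A assume "A \<in> range (grid_cube w :: 'a \<Rightarrow> 'a set)"
    then obtain x where "A = grid_cube w x" by auto
    then have "A = {y. \<forall>i\<in>Basis. \<lfloor>(y \<bullet> i) / w\<rfloor> = restrict (\<lambda>i. \<lfloor>(x \<bullet> i) / w\<rfloor>) Basis i}"
      by (simp add: grid_cube_def)
    moreover have "restrict (\<lambda>i. \<lfloor>(x \<bullet> i) / w\<rfloor>) Basis \<in> Pi\<^sub>E (Basis :: 'a set) (\<lambda>_. UNIV)"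
      by simp
    ultimately show "A \<in> (\<lambda>f. {y. \<forall>i\<in>Basis. \<lfloor>(y \<bullet> i) / w\<rfloor> = f i}) ` (Pi\<^sub>E (Basis :: 'a set) (\<lambda>_. UNIV))"
      by (rule image_eqI)
  qed
  then show ?thesis
    by (rule countable_subset) (intro countable_image countable_PiE, auto)
qed

lemma nested_cells_grid:
  fixes s :: real
  assumes s: "0 < s"
  shows "nested_cells (\<lambda>k. grid_cube (s / 2 ^ k) :: 'a::euclidean_space \<Rightarrow> 'a set)"
proof
  fix k and x y :: 'a and U :: "'a set"
  show "x \<in> grid_cube (s / 2 ^ k) x" by (simp add: grid_cube_def)
  show "y \<in> grid_cube (s / 2 ^ k) x \<Longrightarrow> grid_cube (s / 2 ^ k) y = grid_cube (s / 2 ^ k) x"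
    by (simp add: grid_cube_def)
  show "grid_cube (s / 2 ^ Suc k) x \<subseteq> grid_cube (s / 2 ^ k) x"
    using grid_cube_half[of "s / 2 ^ k" x] by (simp add: mult.commute)
  show "grid_cube (s / 2 ^ k) x \<in> sets borel" by (rule grid_cube_borel)
  show "countable (range (grid_cube (s / 2 ^ k) :: 'a \<Rightarrow> 'a set))" by (rule countable_grid_cubes)
  assume "open U" "x \<in> U"
  then obtain e where e: "0 < e" "ball x e \<subseteq> U" by (auto simp: open_contains_ball)
  have "(\<lambda>k. DIM('a) * s * (1 / 2) ^ k) \<longlonglongrightarrow> DIM('a) * s * 0"
    by (intro tendsto_intros LIMSEQ_power_zero) simp
  then have "\<forall>\<^sub>F k in sequentially. DIM('a) * s * (1 / 2) ^ k < e"
    using e(1) by (intro order_tendstoD(2)) auto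
  then obtain k where k: "DIM('a) * s * (1 / 2) ^ k < e"
    by (auto simp: eventually_sequentially)
  have "grid_cube (s / 2 ^ k) x \<subseteq> ball x e"
  proof
    fix y assume "y \<in> grid_cube (s / 2 ^ k) x"
    then have "dist x y \<le> DIM('a) * (s / 2 ^ k)" using s by (intro dist_grid_cube) auto
    with k show "y \<in> ball x e" by (simp add: power_one_over)
  qed
  with e(2) show "\<exists>k. grid_cube (s / 2 ^ k) x \<subseteq> U" by blast
qed

lemma admissible_radius_bounds:
  assumes "0 < R" "R \<le> admissible_radius c"
  shows "R \<le> 1" "R * norm c \<le> 1"
proof -
  show R1: "R \<le> 1" using assms by (auto simp: admissible_radius_def split: if_splits)
  show "R * norm c \<le> 1"
    using assms by (cases "c = 0") (auto simp: admissible_radius_def field_simps)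
qed

text \<open>On a ball of radius at most \<open>1 / norm c\<close> around \<open>c\<close> the norm of a point exceeds \<open>norm c\<close> by at most
that radius, so the admissible radius shrinks at most by the factor 2.\<close>

lemma admissible_radius_half:
  assumes R: "0 < R" "R \<le> admissible_radius c" and y: "dist c y \<le> R" and \<rho>: "\<rho> \<le> R / 2"
  shows "\<rho> \<le> admissible_radius y"
proof -
  note b = admissible_radius_bounds[OF R]
  have "norm y \<le> norm c + R"
    using norm_triangle_sub[of y c] y by (simp add: dist_norm norm_minus_commute)
  then have "R * norm y \<le> R * norm c + R * R"
    using R(1) by (metis distrib_left less_imp_le mult_left_mono)
  also have "\<dots> \<le> 2" using b R(1) mult_mono[of R 1 R 1] by simp
  finally have "R / 2 \<le> 1 / norm y" if "y \<noteq> 0" using that by (simp add: field_simps)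
  then show ?thesis using \<rho> b by (auto simp: admissible_radius_def)
qed

text \<open>Admissibility is the scale on which the Gauss measure resembles Lebesgue measure: with
\<open>R * norm c \<le> 1\<close> and \<open>R \<le> 1\<close>, the exponent \<open>(norm x)\<^sup>2\<close> varies by at most 8 on the ball of radius
\<open>2 * R\<close>.\<close>

lemma gauss_density_comparable:
  assumes R: "0 < R" "R \<le> admissible_radius c" and x: "dist c x \<le> 2 * R"
  shows "exp (- 8) * gauss_density c \<le> gauss_density x \<and> gauss_density x \<le> exp 8 * gauss_density c"
proof -
  note b = admissible_radius_bounds[OF R]
  have d: "\<bar>norm x - norm c\<bar> \<le> 2 * R"
    using norm_triangle_ineq3[of x c] x by (simp add: dist_norm norm_minus_commute)
  have "\<bar>(norm x)\<^sup>2 - (norm c)\<^sup>2\<bar> = \<bar>norm x - norm c\<bar> * (norm x + norm c)"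
    by (simp add: power2_eq_square square_diff_square_factored abs_mult)
  also have "\<dots> \<le> (2 * R) * (2 * norm c + 2 * R)"
    using d R by (intro mult_mono) auto
  also have "\<dots> = 4 * (R * norm c) + 4 * (R * R)" by (simp add: algebra_simps)
  also have "\<dots> \<le> 8" using b R(1) mult_mono[of R 1 R 1] by simp
  finally have *: "\<bar>(norm x)\<^sup>2 - (norm c)\<^sup>2\<bar> \<le> 8" .
  have "exp (- 8) * exp (- (norm c)\<^sup>2) \<le> exp (- (norm x)\<^sup>2)" "exp (- (norm x)\<^sup>2) \<le> exp 8 * exp (- (norm c)\<^sup>2)"
    using * by (simp_all add: exp_add[symmetric] del: exp_add)
  then show ?thesis
    unfolding gauss_density_def by (simp add: mult.left_commute[of "exp _"])
qed

lemma gauss_measure_comparable: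
  assumes R: "0 < R" "R \<le> admissible_radius c"
    and S: "S \<in> sets borel" "S \<subseteq> cball c (2 * R)" and S': "S' \<in> sets borel" "S' \<subseteq> cball c (2 * R)"
    and le: "measure lborel S \<le> q * measure lborel S'" and q: "0 \<le> q"
  shows "measure gauss S \<le> exp 16 * q * measure gauss S'"
proof -
  let ?g = "gauss_density c"
  have g: "0 < ?g" by (rule gauss_density_pos)
  have bd: "bounded S" "bounded S'" using S S' bounded_subset[OF bounded_cball] by blast+
  have "measure gauss S \<le> (exp 8 * ?g) * measure lborel S"
    by (rule gauss_measure_bounds(2)[where lo="exp (- 8) * ?g"])
      (use S bd g gauss_density_comparable[OF R] in auto)
  also have "\<dots> \<le> (exp 8 * ?g) * (q * measure lborel S')"
    using le g by (intro mult_left_mono) auto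
  also have "\<dots> = exp 16 * q * ((exp (- 8) * ?g) * measure lborel S')"
    using exp_add[of "16::real" "-8"] by simp
  also have "\<dots> \<le> exp 16 * q * measure gauss S'"
  proof (intro mult_left_mono)
    show "(exp (- 8) * ?g) * measure lborel S' \<le> measure gauss S'"
      by (rule gauss_measure_bounds(1)[where hi="exp 8 * ?g"])
        (use S' bd g gauss_density_comparable[OF R] in auto)
  qed (use q in auto)
  finally show ?thesis .
qed

lemma measure_cball_eq:
  "0 \<le> R \<Longrightarrow> measure lborel (cball (c :: 'a::euclidean_space) R) = unit_ball_vol DIM('a) * R ^ DIM('a)"
  using content_cball[of R c] by simp

text \<open>For \<open>B = cball c R\<close> use dyadic cubes starting with side \<open>R / (8 * DIM('a))\<close>. Coarsest cubes then have
diameter at most \<open>R / 8\<close>, and everything relevant stays in the ball of radius \<open>2 * R\<close>, where Gauss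
measures are compared through Lebesgue measures. The ratios of the latter are explicit: each is at
most \<open>C * X ^ DIM('a)\<close> with \<open>X \<le> 8 * DIM('a)\<close> and \<open>C\<close> among \<open>1\<close>, the volume \<open>v\<close> of the unit ball and
\<open>1 / v\<close>.\<close>

lemma admissible_cells_exist:
  "\<exists>\<Theta>. \<forall>B :: 'a::euclidean_space set. admissible_ball B \<longrightarrow> (\<exists>cell N. admissible_cells cell B N \<Theta>)"
proof -
  let ?n = "DIM('a)" and ?d = "real DIM('a)"
  let ?v = "unit_ball_vol ?n"
  let ?q = "(1 + ?v + 1 / ?v) * (8 * ?d) ^ ?n"
  let ?\<Theta> = "exp 16 * ?q"
  have v: "0 < ?v" by simp
  have n: "1 \<le> ?d" using DIM_positive[where 'a='a] by linarith
  have q: "C * X ^ ?n \<le> ?q" if "C \<le> 1 \<or> C \<le> ?v \<or> C \<le> 1 / ?v" "0 \<le> X" "X \<le> 8 * ?d" for C X :: real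
  proof (intro mult_mono power_mono that)
    have "0 < 1 / ?v" using v by simp
    with v that(1) show "C \<le> 1 + ?v + 1 / ?v" "0 \<le> 1 + ?v + 1 / ?v" by linarith+
  qed (use that in auto)
  have n2: "1 \<le> 8 * ?d" "2 \<le> 8 * ?d" "4 \<le> 8 * ?d" using n by linarith+
  have q1: "1 \<le> ?q" using q[of 1 1] n by simp
  then have q0: "0 \<le> ?q" by linarith
  show ?thesis
  proof (intro exI[of _ ?\<Theta>] allI impI)
    fix B :: "'a set" assume B: "admissible_ball B"
    then obtain c R where R: "0 < R" "R \<le> admissible_radius c" and B_eq: "B = cball c R"
      by (auto simp: admissible_ball_def)
    let ?s = "R / (8 * ?d)"
    let ?cell = "\<lambda>k. grid_cube (?s / 2 ^ k) :: 'a \<Rightarrow> 'a set"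
    have s: "0 < ?s" using R n by simp
    have w: "0 < ?s / 2 ^ k" for k by (intro divide_pos_pos[OF s]) simp
    interpret nested_cells ?cell by (rule nested_cells_grid[OF s])
    note cmp = gauss_measure_comparable[OF R]
    have near: "dist x y \<le> R / 8 / 2 ^ k" if "y \<in> ?cell k x" for k x y
    proof -
      have "dist x y \<le> ?d * (?s / 2 ^ k)"
        by (rule dist_grid_cube[OF w that])
      also have "\<dots> = R / 8 / 2 ^ k" using n by simp
      finally show ?thesis .
    qed
    have near': "dist x y \<le> R / 8" if "y \<in> ?cell k x" for k x y
    proof -
      have "R / 8 / 2 ^ k \<le> R / 8 / 1" using R(1) by (intro divide_left_mono) auto
      with near[OF that] show ?thesis by simp
    qed
    have cell_sub: "?cell k x \<subseteq> cball c (2 * R)" if "x \<in> B" for k x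
    proof
      fix y assume "y \<in> ?cell k x"
      from near'[OF this] that R(1) dist_triangle[of c y x] show "y \<in> cball c (2 * R)"
        by (simp add: B_eq)
    qed
    have vol_cell: "measure lborel (?cell k x) = (?s / 2 ^ k) ^ ?n" for k x
      by (rule measure_grid_cube[OF w])
    have vol_ball: "measure lborel (cball y (X * (?s / 2 ^ k))) = ?v * X ^ ?n * (?s / 2 ^ k) ^ ?n"
      if "0 \<le> X" for y :: 'a and X k
    proof -
      have "0 \<le> X * (?s / 2 ^ k)" by (intro mult_nonneg_nonneg that less_imp_le[OF w])
      then show ?thesis by (simp only: measure_cball_eq power_mult_distrib mult.assoc)
    qed
    have ball_sub: "cball y \<rho> \<subseteq> cball c (2 * R)" if "dist c y \<le> R" "\<rho> \<le> R" for y \<rho>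
      using that dist_triangle[of c _ y] by (auto simp: subset_iff) (smt (verit))
    have adm: "admissible_ball (cball y \<rho>)" if "dist c y \<le> R" "0 < \<rho>" "\<rho> \<le> R / 2" for y \<rho>
      unfolding admissible_ball_def using admissible_radius_half[OF R that(1,3)] that(2) by blast
    have R_eq: "R = (8 * ?d) * (?s / 2 ^ 0)" using n by simp
    show "\<exists>cell N. admissible_cells cell B N ?\<Theta>"
    proof (intro exI)
      show "admissible_cells ?cell B (cball c (2 * R)) ?\<Theta>"
      proof
        show "admissible_ball B" by (rule B)
        show "cball c (2 * R) \<in> sets borel" by simp
        show "1 \<le> ?\<Theta>" using q1 mult_mono[of 1 "exp 16" 1 ?q] by simp
        show "measure gauss (cball c (2 * R)) \<le> ?\<Theta> * measure gauss B"
        proof (rule cmp)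
          show "measure lborel (cball c (2 * R)) \<le> ?q * measure lborel B"
            using q[of 1 2] n R(1) v
            by (simp add: B_eq measure_cball_eq power_mult_distrib mult_right_mono mult.left_commute[of ?v])
        qed (use q1 R B_eq in auto)
        fix x assume x: "x \<in> B"
        show "?cell 0 x \<subseteq> cball c (2 * R)" by (rule cell_sub[OF x])
        show "measure gauss B \<le> ?\<Theta> * measure gauss (?cell 0 x)"
        proof (rule cmp)
          have "measure lborel B = ?v * (8 * ?d) ^ ?n * measure lborel (?cell 0 x)"
            unfolding B_eq vol_cell by (subst R_eq, subst vol_ball) auto
          also have "\<dots> \<le> ?q * measure lborel (?cell 0 x)"
            by (intro mult_right_mono q) auto
          finally show "measure lborel B \<le> ?q * measure lborel (?cell 0 x)" .
        qed (use q1 R B_eq cell_sub[OF x, of 0] cell_borel[of 0 x] in auto)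
        fix k
        show "measure gauss (?cell k x) \<le> ?\<Theta> * measure gauss (?cell (Suc k) x)"
        proof (rule cmp)
          have "measure lborel (?cell k x) = 1 * 2 ^ ?n * measure lborel (?cell (Suc k) x)"
          proof -
            have "?s / 2 ^ k = 2 * (?s / 2 ^ Suc k)" by simp
            then have "(?s / 2 ^ k) ^ ?n = 2 ^ ?n * (?s / 2 ^ Suc k) ^ ?n" by (metis power_mult_distrib)
            then show ?thesis unfolding vol_cell by (simp only: mult_1)
          qed
          also have "\<dots> \<le> ?q * measure lborel (?cell (Suc k) x)"
            by (intro mult_right_mono q) (use n2 in auto)
          finally show "measure lborel (?cell k x) \<le> ?q * measure lborel (?cell (Suc k) x)" .
        qed (rule cell_borel cell_sub[OF x] q0 | simp)+
        have cx: "dist c x \<le> R" using x by (simp add: B_eq)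
        show "\<exists>F. admissible_ball F \<and> ?cell k x \<subseteq> F \<and> measure gauss F \<le> ?\<Theta> * measure gauss (?cell k x)"
        proof (intro exI conjI)
          let ?\<rho> = "?d * (?s / 2 ^ k)"
          have \<rho>: "0 < ?\<rho>" by (intro mult_pos_pos w) (use n in simp)
          have \<rho>_eq: "?\<rho> = R / 8 / 2 ^ k" using n by simp
          also have "\<dots> \<le> R / 8 / 1" using R(1) by (intro divide_left_mono) auto
          finally have \<rho>R: "?\<rho> \<le> R / 8" by simp
          show "admissible_ball (cball x ?\<rho>)" using \<rho> \<rho>R R(1) by (intro adm cx) auto
          show "?cell k x \<subseteq> cball x ?\<rho>" using near[of _ k x] unfolding \<rho>_eq by auto
          show "measure gauss (cball x ?\<rho>) \<le> ?\<Theta> * measure gauss (?cell k x)"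
          proof (rule cmp)
            have "measure lborel (cball x ?\<rho>) = ?v * ?d ^ ?n * measure lborel (?cell k x)"
              unfolding vol_cell by (subst vol_ball) auto
            also have "\<dots> \<le> ?q * measure lborel (?cell k x)"
              by (intro mult_right_mono q) auto
            finally show "measure lborel (cball x ?\<rho>) \<le> ?q * measure lborel (?cell k x)" .
            show "cball x ?\<rho> \<subseteq> cball c (2 * R)" using \<rho>R R(1) by (intro ball_sub cx) auto
          qed (rule cell_borel cell_sub[OF x] q0 | simp)+
        qed
        \<comment> \<open>moving a quarter of the way to the centre leaves room for a ball of radius \<open>R / 4\<close> inside \<open>B\<close>\<close>
        define y where "y = c + (3/4) *\<^sub>R (x - c)"
        have "y - c = (3/4) *\<^sub>R (x - c)" by (simp add: y_def)
        then have cy: "dist c y \<le> 3/4 * R"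
          using cx by (simp add: dist_norm norm_minus_commute[of c])
        have "x - y = (1 - 3/4) *\<^sub>R (x - c)"
          unfolding y_def scaleR_diff_left by simp
        then have xy: "dist x y \<le> R / 4"
          using cx by (simp add: dist_norm norm_minus_commute[of c])
        have cyR: "dist c y \<le> R" using cy R(1) by simp
        show "\<exists>E F. E \<in> sets borel \<and> admissible_ball F \<and> E \<subseteq> B \<and> E \<subseteq> F \<and> ?cell 0 x \<subseteq> F \<and>
            measure gauss B \<le> ?\<Theta> * measure gauss E \<and>
            measure gauss (?cell 0 x) \<le> ?\<Theta> * measure gauss E \<and>
            measure gauss F \<le> ?\<Theta> * measure gauss (?cell 0 x)"
        proof (intro exI conjI)
          let ?E = "cball y (R / 4)" and ?F = "cball y (R / 2)"
          have E_eq: "R / 4 = (2 * ?d) * (?s / 2 ^ 0)" using n by simp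
          have F_eq: "R / 2 = (4 * ?d) * (?s / 2 ^ 0)" using n by simp
          have E_sub: "?E \<subseteq> cball c (2 * R)" using R(1) by (intro ball_sub cyR) auto
          show "?E \<in> sets borel" by simp
          show "admissible_ball ?F" using R(1) by (intro adm cyR) auto
          show "?E \<subseteq> B"
          proof
            fix z assume "z \<in> ?E"
            then show "z \<in> B" using cy dist_triangle[of c z y] by (simp add: B_eq)
          qed
          show "?E \<subseteq> ?F" using R(1) by auto
          show "?cell 0 x \<subseteq> ?F"
          proof
            fix z assume "z \<in> ?cell 0 x"
            from near'[OF this] xy R(1) dist_triangle[of y z x] show "z \<in> ?F"
              by (simp add: dist_commute)
          qed
          show "measure gauss B \<le> ?\<Theta> * measure gauss ?E"
          proof (rule cmp)
            have "measure lborel B = 1 * 4 ^ ?n * measure lborel ?E"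
              using R(1) by (simp add: B_eq measure_cball_eq power_divide)
            also have "\<dots> \<le> ?q * measure lborel ?E"
              by (intro mult_right_mono q) (use n2 in auto)
            finally show "measure lborel B \<le> ?q * measure lborel ?E" .
          qed (use q1 R B_eq E_sub in auto)
          show "measure gauss (?cell 0 x) \<le> ?\<Theta> * measure gauss ?E"
          proof (rule cmp)
            have 1: "1 \<le> (2 * ?d) ^ ?n" using n by (intro one_le_power) linarith
            have "measure lborel (?cell 0 x) = 1 / ?v * 1 ^ ?n * (?v * 1 * (?s / 2 ^ 0) ^ ?n)"
              unfolding vol_cell using less_imp_neq[OF v] by simp
            also have "\<dots> \<le> ?q * (?v * (2 * ?d) ^ ?n * (?s / 2 ^ 0) ^ ?n)"
              using 1 v s n2 by (intro mult_mono q mult_left_mono mult_right_mono) auto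
            also have "?v * (2 * ?d) ^ ?n * (?s / 2 ^ 0) ^ ?n = measure lborel ?E"
              by (subst E_eq, subst vol_ball) auto
            finally show "measure lborel (?cell 0 x) \<le> ?q * measure lborel ?E" .
          qed (rule cell_borel cell_sub[OF x] q0 E_sub | simp)+
          show "measure gauss ?F \<le> ?\<Theta> * measure gauss (?cell 0 x)"
          proof (rule cmp)
            have "measure lborel ?F = ?v * (4 * ?d) ^ ?n * measure lborel (?cell 0 x)"
              unfolding vol_cell by (subst F_eq, subst vol_ball) auto
            also have "\<dots> \<le> ?q * measure lborel (?cell 0 x)"
              by (intro mult_right_mono q) auto
            finally show "measure lborel ?F \<le> ?q * measure lborel (?cell 0 x)" .
            show "?F \<subseteq> cball c (2 * R)" using R(1) by (intro ball_sub cyR) auto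
          qed (rule cell_borel cell_sub[OF x] q0 | simp)+
        qed
      qed
    qed
  qed
qed

section \<open>Equality of the Hardy spaces\<close>

text \<open>The constant depends only on \<open>p\<close> and the dimension, as \<open>\<Theta>\<close> does not depend on the ball of the atom.\<close>

lemma real_atom_split:
  assumes p: "1 < p"
  obtains K where "0 < K" "\<And>a :: 'a::euclidean_space \<Rightarrow> complex. gauss_atom (ereal p) a \<Longrightarrow>
    \<exists>u v. u \<in> atomic_hull gauss {a. gauss_atom \<infinity> a} K \<and>
      v \<in> atomic_hull gauss {a. gauss_atom (ereal p) a} (1 / 2) \<and> (AE x in gauss. a x = u x + v x)"
proof -
  obtain \<Theta> where ex: "\<And>B :: 'a set. admissible_ball B \<Longrightarrow> \<exists>cell N. admissible_cells cell B N \<Theta>"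
    using admissible_cells_exist by blast
  have \<Theta>: "1 \<le> \<Theta>"
  proof -
    have "admissible_ball (cball (0 :: 'a) 1)"
      unfolding admissible_ball_def admissible_radius_def
      by (rule exI[of _ 0], rule exI[of _ 1]) simp
    then obtain cell N where "admissible_cells cell (cball (0 :: 'a) 1) N \<Theta>" using ex by blast
    then show ?thesis by (rule admissible_cells.\<Theta>)
  qed
  \<comment> \<open>large enough for both conditions on the height of the decomposition\<close>
  define t where "t = \<Theta> + (8 * \<Theta> * (1 + \<Theta>)) powr (1 / (p - 1))"
  have t: "\<Theta> \<le> t" by (simp add: t_def)
  have t': "8 * \<Theta> * (1 + \<Theta>) \<le> t powr (p - 1)"
  proof -
    have "8 * \<Theta> * (1 + \<Theta>) = ((8 * \<Theta> * (1 + \<Theta>)) powr (1 / (p - 1))) powr (p - 1)"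
      using p \<Theta> by (simp add: powr_powr)
    also have "\<dots> \<le> t powr (p - 1)"
      using p \<Theta> by (intro powr_mono2) (auto simp: t_def)
    finally show ?thesis .
  qed
  define K where "K = (1 + \<Theta>) * t * \<Theta>\<^sup>2 * (3 + \<Theta>)"
  have K: "1 \<le> K"
  proof -
    have "1 * 1 * 1 * 1 \<le> (1 + \<Theta>) * t * \<Theta>\<^sup>2 * (3 + \<Theta>)"
      using \<Theta> t by (intro mult_mono) auto
    then show ?thesis by (simp add: K_def)
  qed
  show ?thesis
  proof (rule that[of K])
    show "0 < K" using K by simp
    fix a :: "'a \<Rightarrow> complex" assume a: "gauss_atom (ereal p) a"
    show "\<exists>u v. u \<in> atomic_hull gauss {a. gauss_atom \<infinity> a} K \<and>
      v \<in> atomic_hull gauss {a. gauss_atom (ereal p) a} (1 / 2) \<and> (AE x in gauss. a x = u x + v x)"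
    proof (cases "a = (\<lambda>_. 1)")
      case True
      have "(\<lambda>x. 1 * a x) \<in> atomic_hull gauss {a. gauss_atom \<infinity> a} (norm (1 :: complex))"
        by (rule atomic_hull_single) (simp_all add: True gauss_atom_def)
      then have "a \<in> atomic_hull gauss {a. gauss_atom \<infinity> a} K"
        using K by (auto intro: atomic_hull_mono)
      moreover have "(\<lambda>x. 0) \<in> atomic_hull gauss {a :: 'a \<Rightarrow> complex. gauss_atom (ereal p) a} (1 / 2)"
        by (rule atomic_hull_zero[OF L1_bounded_gauss_atoms_real[OF p]]) simp
      ultimately show ?thesis by (intro exI[of _ a] exI[of _ "\<lambda>x. 0"]) simp
    next
      case False
      then obtain B where m: "a \<in> borel_measurable borel" and i: "integrable gauss (\<lambda>x. norm (a x) powr p)"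
        and B: "admissible_ball B" and supp: "AE x in gauss. x \<notin> B \<longrightarrow> a x = 0"
        and mean: "(\<integral>x. a x \<partial>gauss) = 0"
        and le: "(\<integral>x. norm (a x) powr p \<partial>gauss) \<le> measure gauss B powr (1 - p)"
        using a unfolding gauss_atom_real_iff[OF p] by blast
      obtain cell N where "admissible_cells cell B N \<Theta>" using ex[OF B] by blast
      then interpret admissible_cells cell B N \<Theta> .
      \<comment> \<open>an atom vanishes outside its ball only almost everywhere; the decomposition uses a version that vanishes everywhere\<close>
      define b where "b x = indicator B x * a x" for x
      have bm: "b \<in> borel_measurable borel" using m B_borel unfolding b_def by measurable
      have ab: "AE x in gauss. b x = a x"
        using supp by eventually_elim (auto simp: b_def indicator_def)
      have m1: "(\<lambda>x. norm (a x) powr p) \<in> borel_measurable gauss"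
        "(\<lambda>x. norm (b x) powr p) \<in> borel_measurable gauss"
        using m bm by simp_all
      have ab': "AE x in gauss. norm (b x) powr p = norm (a x) powr p"
        using ab by eventually_elim simp
      have bi: "integrable gauss (\<lambda>x. norm (b x) powr p)"
        using i integrable_cong_AE[OF m1(2,1) ab'] by simp
      have beq: "(\<integral>x. norm (b x) powr p \<partial>gauss) = (\<integral>x. norm (a x) powr p \<partial>gauss)"
        by (rule integral_cong_AE[OF m1(2,1) ab'])
      have bmean: "(\<integral>x. b x \<partial>gauss) = 0"
        unfolding mean[symmetric] by (rule integral_cong_AE) (use m bm ab in auto)
      have "\<exists>u v. u \<in> atomic_hull gauss {a. gauss_atom \<infinity> a} ((1 + \<Theta>) * t * \<Theta>\<^sup>2 * (3 + \<Theta>)) \<and>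
        v \<in> atomic_hull gauss {a. gauss_atom (ereal p) a} (1 / 2) \<and> (\<forall>x. b x = u x + v x)"
        by (rule atom_split[OF p bm _ bmean bi _ t t']) (use le beq in \<open>auto simp: b_def\<close>)
      then obtain u v where "u \<in> atomic_hull gauss {a. gauss_atom \<infinity> a} K"
        "v \<in> atomic_hull gauss {a. gauss_atom (ereal p) a} (1 / 2)" "\<forall>x. b x = u x + v x"
        unfolding K_def by blast
      moreover have "AE x in gauss. a x = u x + v x"
        using ab by eventually_elim (use calculation(3) in simp)
      ultimately show ?thesis by blast
    qed
  qed
qed

lemma real_hull_subset_infinity_hull:
  assumes p: "1 < p"
  obtains C where "0 < C" "\<And>S. atomic_hull gauss {a :: 'a::euclidean_space \<Rightarrow> complex. gauss_atom (ereal p) a} S \<subseteq>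
    atomic_hull gauss {a. gauss_atom \<infinity> a} (C * S)"
proof -
  obtain K where K: "0 < K" "\<And>a :: 'a \<Rightarrow> complex. gauss_atom (ereal p) a \<Longrightarrow>
    \<exists>u v. u \<in> atomic_hull gauss {a. gauss_atom \<infinity> a} K \<and>
      v \<in> atomic_hull gauss {a. gauss_atom (ereal p) a} (1 / 2) \<and> (AE x in gauss. a x = u x + v x)"
    using real_atom_split[OF p, where ?'a='a] by blast
  show ?thesis
  proof (rule that[of "2 * K"])
    fix S
    show "atomic_hull gauss {a :: 'a \<Rightarrow> complex. gauss_atom (ereal p) a} S \<subseteq>
        atomic_hull gauss {a. gauss_atom \<infinity> a} (2 * K * S)"
      using atomic_hull_iterate[OF L1_bounded_gauss_atoms_real[OF p, where ?'a='a]
          L1_bounded_gauss_atoms_infinity[where ?'a='a], of K] K(2) by blast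
  qed (use K(1) in simp)
qed

theorem theorem2p2:
  fixes r :: ereal
  assumes "1 < r" and "r < \<infinity>"
  shows "(gauss_hardy r :: (real ^ 'n \<Rightarrow> complex) set) = gauss_hardy \<infinity> \<and>
    (\<exists>c C. 0 < c \<and> 0 < C \<and>
      (\<forall>f \<in> (gauss_hardy r :: (real ^ 'n \<Rightarrow> complex) set).
         c * gauss_hardy_norm \<infinity> f \<le> gauss_hardy_norm r f \<and>
         gauss_hardy_norm r f \<le> C * gauss_hardy_norm \<infinity> f))"
proof -
  obtain p where r: "r = ereal p" and p: "1 < p"
    using assms by (cases r) (auto simp: one_ereal_def)
  note Lr = L1_bounded_gauss_atoms_real[OF p, where ?'a="real ^ 'n", folded r]
  note Linf = L1_bounded_gauss_atoms_infinity[where ?'a="real ^ 'n"]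
  obtain C where C: "0 < C" and sub: "\<And>S. atomic_hull gauss {a :: real ^ 'n \<Rightarrow> complex. gauss_atom r a} S \<subseteq>
    atomic_hull gauss {a. gauss_atom \<infinity> a} (C * S)"
    using real_hull_subset_infinity_hull[OF p, where ?'a="real ^ 'n"] unfolding r by blast
  have sub': "atomic_hull gauss {a :: real ^ 'n \<Rightarrow> complex. gauss_atom \<infinity> a} S \<subseteq>
    atomic_hull gauss {a. gauss_atom r a} S" for S
    using gauss_atom_infinity_imp_real[OF p] unfolding atomic_hull_def r by blast
  have eq: "(gauss_hardy r :: (real ^ 'n \<Rightarrow> complex) set) = gauss_hardy \<infinity>"
  proof (intro equalityI subsetI)
    fix f :: "real ^ 'n \<Rightarrow> complex" assume f: "f \<in> gauss_hardy r"
    then obtain S where "f \<in> atomic_hull gauss {a. gauss_atom r a} S"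
      by (rule gauss_hardy_imp_atomic_hull[OF Lr])
    then have "f \<in> atomic_hull gauss {a. gauss_atom \<infinity> a} (C * S)" using sub by blast
    then show "f \<in> gauss_hardy \<infinity>"
      using f by (intro gauss_hardy_norm_le(1)[OF Linf]) (auto simp: gauss_hardy_def)
  next
    fix f :: "real ^ 'n \<Rightarrow> complex" assume f: "f \<in> gauss_hardy \<infinity>"
    then obtain S where "f \<in> atomic_hull gauss {a. gauss_atom \<infinity> a} S"
      by (rule gauss_hardy_imp_atomic_hull[OF Linf])
    then have "f \<in> atomic_hull gauss {a. gauss_atom r a} S" using sub' by blast
    then show "f \<in> gauss_hardy r"
      using f by (intro gauss_hardy_norm_le(1)[OF Lr]) (auto simp: gauss_hardy_def)
  qed
  have norms: "1 / C * gauss_hardy_norm \<infinity> f \<le> gauss_hardy_norm r f \<and>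
      gauss_hardy_norm r f \<le> 1 * gauss_hardy_norm \<infinity> f"
    if f: "f \<in> gauss_hardy r" for f :: "real ^ 'n \<Rightarrow> complex"
  proof
    have int: "integrable gauss f" using f by (simp add: gauss_hardy_def)
    show "1 / C * gauss_hardy_norm \<infinity> f \<le> gauss_hardy_norm r f"
    proof (rule le_gauss_hardy_norm[OF Lr f])
      fix S assume "f \<in> atomic_hull gauss {a. gauss_atom r a} S"
      then have "f \<in> atomic_hull gauss {a. gauss_atom \<infinity> a} (C * S)" using sub by blast
      from gauss_hardy_norm_le(2)[OF Linf int this] show "1 / C * gauss_hardy_norm \<infinity> f \<le> S"
        using C by (simp add: field_simps)
    qed
    have "gauss_hardy_norm r f \<le> gauss_hardy_norm \<infinity> f"
    proof (rule le_gauss_hardy_norm[OF Linf])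
      show "f \<in> gauss_hardy \<infinity>" using f eq by simp
      fix S assume "f \<in> atomic_hull gauss {a. gauss_atom \<infinity> a} S"
      then have "f \<in> atomic_hull gauss {a. gauss_atom r a} S" using sub' by blast
      then show "gauss_hardy_norm r f \<le> S" by (rule gauss_hardy_norm_le(2)[OF Lr int])
    qed
    then show "gauss_hardy_norm r f \<le> 1 * gauss_hardy_norm \<infinity> f" by simp
  qed
  show ?thesis
    using eq norms C by (intro conjI exI[of _ "1 / C"] exI[of _ 1] ballI) auto
qed

end
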